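(* Let $m\ge1$ be an integer, let $(\mathcal M,+,0)$ be a commutative monoid, and let $S=(s_i)_{i\ge1}$ be a sequence in $\mathcal M$ with $s_{i+m}=s_i$ for all $i\ge1$. Suppose that $c_m=c_0=1$. Then, at fixed $S$-weight and color sequence, there are as many over-partitions in $\overline{\mathcal F}$ as over-partitions in $\overline{\mathcal F}_m$.
   Context: Over-lined integers: $\overline{\mathbb{Z}_{\geq 1}}=\{\overline1,\overline2,\ldots\}$ is a disjoint copy of $\mathbb{Z}_{\ge 1}$; both $i$ and $\overline i$ have size $i$; sums, differences and multiples use sizes. Order: $0<\overline1<1<\overline2<2<\cdots$. An over-partition is an infinite non-increasing sequence $\lambda=(\lambda_i)_{i\ge1}$ of elements of $\mathbb{Z}_{\geq 0}\sqcup\overline{\mathbb{Z}_{\geq 1}}$ with finitely many nonzero terms, in which each over-lined integer occurs at most once. Write $\chi(A)=1$ if $A$ is true and $0$ otherwise. $\overline{\mathcal F}$: over-partitions $\lambda$ such that $\overline i$ is a part of $\lambda$ for all $\overline i\le\lambda_1$ (equivalently $\lambda_i-\lambda_{i+1}=\chi(\lambda_i\text{ is over-lined})$ for all $i\ge1$). $\overline{\mathcal F}_m$: over-partitions $\lambda$ in which every positive integer has fewer than $m$ non-over-lined occurrences and such that $\lambda_i-\lambda_{i+1}=\chi(\lambda_i\text{ is over-lined})$ for all $i\ge1$ not divisible by $m$. The $S$-weight is $|\lambda|_S=\sum_{i\ge1}\lambda_i\cdot s_i\in\mathcal M$. The colors $c_j, c_{\overline j}$ are commuting indeterminates that are $m$-periodic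 in the index ($c_{u+m}=c_u$, $c_{\overline{u+m}}=c_{\overline u}$), and the color sequence of $\lambda$ is $C(\lambda)=\prod_{j=1}^m c_j^{\rho_j(\lambda)}c_{\overline j}^{\rho_{\overline j}(\lambda)}$, where $$\rho_j(\lambda)=\sum_{i\ge0}\bigl(\lambda_{j+im}-\lambda_{j+1+im}-\chi(\lambda_{j+im}\text{ is over-lined})\bigr),\qquad \rho_{\overline j}(\lambda)=\#\{i\ge0:\lambda_{j+im}\text{ is over-lined}\}.$$ With $c_m=1$, the color sequence of an element of $\overline{\mathcal F}$ or $\overline{\mathcal F}_m$ is $\prod_{j=1}^m c_{\overline j}^{\rho_{\overline j}(\lambda)}$. *)

theory Defs
  imports "HOL-Library.Equipollence"
begin

text \<open>
  Elements of \<open>\<int>\<^bsub>\<ge>0\<^esub>\<close> together with the over-lined copy of \<open>\<int>\<^bsub>\<ge>1\<^esub>\<close>. The value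
  \<open>Overlined 0\<close> is not a legal part; it is excluded in the definition of over-partitions.
\<close>

datatype opart = Plain (psize: nat) | is_overlined: Overlined (psize: nat)

text \<open>\<open>0 < Overlined 1 < 1 < Overlined 2 < 2 < \<dots>\<close>\<close>

instantiation opart :: linorder
begin

definition less_eq_opart :: "opart \<Rightarrow> opart \<Rightarrow> bool" where
  "p \<le> q \<longleftrightarrow> psize p < psize q \<or>
             (psize p = psize q \<and> (is_overlined p \<or> \<not> is_overlined q))"

definition less_opart :: "opart \<Rightarrow> opart \<Rightarrow> bool" where
  "p < q \<longleftrightarrow> psize p < psize q \<or>
             (psize p = psize q \<and> is_overlined p \<and> \<not> is_overlined q)"

instance
proof
  fix p q r :: opart
  show "p < q \<longleftrightarrow> p \<le> q \<and> \<not> q \<le> p"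
    by (auto simp: less_eq_opart_def less_opart_def)
  show "p \<le> p"
    by (auto simp: less_eq_opart_def)
  show "p \<le> q \<Longrightarrow> q \<le> r \<Longrightarrow> p \<le> r"
    by (auto simp: less_eq_opart_def)
  show "p \<le> q \<Longrightarrow> q \<le> p \<Longrightarrow> p = q"
    by (cases p; cases q) (auto simp: less_eq_opart_def)
  show "p \<le> q \<or> q \<le> p"
    by (auto simp: less_eq_opart_def)
qed

end

text \<open>
  Sequences \<open>(\<lambda>\<^sub>i)\<^bsub>i\<ge>1\<^esub>\<close> are functions on \<^typ>\<open>nat\<close> whose meaningless value at index \<open>0\<close> is fixed to
  \<open>Plain 0\<close>, so that distinct functions represent distinct over-partitions.
\<close>

definition overpartition :: "(nat \<Rightarrow> opart) \<Rightarrow> bool" where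
  "overpartition l \<longleftrightarrow>
     l 0 = Plain 0 \<and>
     (\<forall>i. l i \<noteq> Overlined 0) \<and>
     (\<forall>i\<ge>1. l (i + 1) \<le> l i) \<and>
     finite {i. i \<ge> 1 \<and> l i \<noteq> Plain 0} \<and>
     (\<forall>k i j. i \<ge> 1 \<and> j \<ge> 1 \<and> l i = Overlined k \<and> l j = Overlined k \<longrightarrow> i = j)"

definition Fbar :: "(nat \<Rightarrow> opart) set" where
  "Fbar = {l. overpartition l \<and>
              (\<forall>k\<ge>1. Overlined k \<le> l 1 \<longrightarrow> (\<exists>i\<ge>1. l i = Overlined k))}"

definition Fbar_m :: "nat \<Rightarrow> (nat \<Rightarrow> opart) set" where
  "Fbar_m m = {l. overpartition l \<and>
                  (\<forall>k\<ge>1. card {i. i \<ge> 1 \<and> l i = Plain k} < m) \<and>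
                  (\<forall>i\<ge>1. \<not> m dvd i \<longrightarrow>
                     int (psize (l i)) - int (psize (l (i + 1))) = of_bool (is_overlined (l i)))}"

text \<open>The inner sum is the \<open>\<lambda>\<^sub>i\<close>-fold multiple of \<open>s\<^sub>i\<close>; only nonzero parts contribute.\<close>

definition S_weight :: "(nat \<Rightarrow> 'a::comm_monoid_add) \<Rightarrow> (nat \<Rightarrow> opart) \<Rightarrow> 'a" where
  "S_weight s l = (\<Sum>i | i \<ge> 1 \<and> l i \<noteq> Plain 0. \<Sum>_<psize (l i). s i)"

text \<open>
  For \<open>j \<ge> 1\<close> and an over-partition, the terms with \<open>\<lambda>\<^bsub>j+im\<^esub> = 0\<close> vanish, and the truncating
  subtraction is exact: an over-lined part is followed by a part of strictly smaller size.
\<close>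

definition rho :: "nat \<Rightarrow> nat \<Rightarrow> (nat \<Rightarrow> opart) \<Rightarrow> nat" where
  "rho m j l = (\<Sum>i | l (j + i * m) \<noteq> Plain 0.
     psize (l (j + i * m)) - psize (l (j + 1 + i * m)) - of_bool (is_overlined (l (j + i * m))))"

definition rho_bar :: "nat \<Rightarrow> nat \<Rightarrow> (nat \<Rightarrow> opart) \<Rightarrow> nat" where
  "rho_bar m j l = card {i. is_overlined (l (j + i * m))}"

definition color_sequence ::
  "(nat \<Rightarrow> 'c::comm_monoid_mult) \<Rightarrow> (nat \<Rightarrow> 'c) \<Rightarrow> nat \<Rightarrow> (nat \<Rightarrow> opart) \<Rightarrow> 'c" where
  "color_sequence c cbar m l = (\<Prod>j=1..m. c j ^ rho m j l * cbar j ^ rho_bar m j l)"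

text \<open>
  Commuting indeterminates subject to \<open>c\<^sub>0 = c\<^sub>m = 1\<close>: apart from the periodicity and this
  specialization there is no relation among the colors, that is, the monomials in
  \<open>c\<^sub>1, \<dots>, c\<^bsub>m-1\<^esub>, cbar\<^sub>1, \<dots>, cbar\<^sub>m\<close> are pairwise distinct.
\<close>

definition independent_colors ::
  "nat \<Rightarrow> (nat \<Rightarrow> 'c::comm_monoid_mult) \<Rightarrow> (nat \<Rightarrow> 'c) \<Rightarrow> bool" where
  "independent_colors m c cbar \<longleftrightarrow>
     (\<forall>(a :: nat \<Rightarrow> nat) b a' b'.
        (\<Prod>j=1..<m. c j ^ a j) * (\<Prod>j=1..m. cbar j ^ b j) =
        (\<Prod>j=1..<m. c j ^ a' j) * (\<Prod>j=1..m. cbar j ^ b' j) \<longrightarrow>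
        (\<forall>j\<in>{1..<m}. a j = a' j) \<and> (\<forall>j\<in>{1..m}. b j = b' j))"

end

theory Submission
  imports Defs "HOL-Library.Multiset"
begin

text \<open>
  An element of \<open>Fbar\<close> is determined by the finite set of positions of its over-lined parts. An element
  of \<open>Fbar_m m\<close> is determined by the word whose \<open>x\<close>-th letter is the residue in \<open>{1..m}\<close> of the position
  of the over-lined part of size \<open>x + 1\<close>, or \<open>0\<close> if there is no such part; every word occurs. In both
  cases the weight is the sum of the initial sums \<open>s\<^sub>1 + \<dots> + s\<^sub>a\<close> over the nonzero residues \<open>a\<close> plus a
  multiple of \<open>s\<^sub>1 + \<dots> + s\<^sub>m\<close>. For \<open>Fbar_m m\<close> the multiplicity is a major index of the word: the sum of
  the \<open>x\<close> whose letter is nonzero and at least the preceding letter. For \<open>Fbar\<close> it becomes the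
  corresponding number of inversions once each position \<open>m * k + a\<close> is read as a letter \<open>a\<close> preceded by
  exactly \<open>k\<close> letters \<open>\<le> a\<close>. Foata's second fundamental transformation carries one statistic to the
  other and preserves the content of the word, hence the color sequence.
\<close>

section \<open>Words, major index and inversions\<close>

text \<open>
  Words are stored backwards: the head of the list is the last letter, so the letter added by \<open>a # w\<close>
  has index \<open>length w\<close>. Leading zeros of the list are insignificant.
\<close>

fun wmaj :: "nat list \<Rightarrow> nat" where
  "wmaj [] = 0"
| "wmaj (a # w) = wmaj w + (if w \<noteq> [] \<and> 0 < a \<and> hd w \<le> a then length w else 0)"

definition count_le :: "nat \<Rightarrow> nat list \<Rightarrow> nat" where
  "count_le a w = length (filter (\<lambda>x. x \<le> a) w)"

lemma count_le_simps [simp]: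
  "count_le a [] = 0"
  "count_le a (x # w) = (if x \<le> a then 1 else 0) + count_le a w"
  "count_le a (v @ w) = count_le a v + count_le a w"
  by (simp_all add: count_le_def)

lemma count_le_cong_mset: "mset v = mset w \<Longrightarrow> count_le a v = count_le a w"
  by (simp add: count_le_def flip: size_mset) 

lemma count_le_eq_length: "\<forall>x\<in>set w. x \<le> a \<Longrightarrow> count_le a w = length w"
  by (simp add: count_le_def)

text \<open>Zeros may be the earlier letter of a counted pair but never the later one, just as
  \<open>wmaj\<close> skips every index whose letter is \<open>0\<close>.\<close>

fun winv :: "nat list \<Rightarrow> nat" where
  "winv [] = 0"
| "winv (a # w) = winv w + (if 0 < a then count_le a w else 0)"

section \<open>Foata's second fundamental transformation\<close>

text \<open>
  If the head satisfies \<open>P\<close>, the list is cut before every element satisfying \<open>P\<close>, and the first element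
  of each block moves to the end of its block.
\<close>

fun rotate_blocks :: "('a \<Rightarrow> bool) \<Rightarrow> 'a list \<Rightarrow> 'a list" where
  "rotate_blocks P [] = []"
| "rotate_blocks P [y] = [y]"
| "rotate_blocks P (y # x # v) =
     (if P x then y # rotate_blocks P (x # v) else x # rotate_blocks P (y # v))"

lemma mset_rotate_blocks [simp]: "mset (rotate_blocks P v) = mset v"
  by (induction P v rule: rotate_blocks.induct) auto

lemma length_rotate_blocks [simp]: "length (rotate_blocks P v) = length v"
  by (metis mset_rotate_blocks size_mset)

lemma rotate_blocks_eq_Nil [simp]: "rotate_blocks P v = [] \<longleftrightarrow> v = []"
  by (metis length_0_conv length_rotate_blocks)

text \<open>The first element of the final block is moved to the very end. This later shows which of
  the two rotations was applied.\<close>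

lemma last_rotate_blocks:
  "v \<noteq> [] \<Longrightarrow> P (hd v) \<Longrightarrow> P (last (rotate_blocks P v))"
  by (induction P v rule: rotate_blocks.induct) auto

text \<open>The cuts can be read off the image: after the rotation each block ends, instead of
  begins, with its only element satisfying \<open>P\<close>.\<close>

lemma rotate_blocks_inject:
  assumes "rotate_blocks P v = rotate_blocks P v'" "v \<noteq> []" "P (hd v)" "P (hd v')"
  shows "v = v'"
  using assms
proof (induction P v arbitrary: v' rule: rotate_blocks.induct)
  case (1 P)
  then show ?case by simp
next
  case (2 P y)
  then have "length v' = 1"
    by (metis length_Cons length_rotate_blocks list.size(3) One_nat_def)
  with 2 show ?case
    by (cases v') auto
next
  case (3 P y x v)
  then have "length v' = Suc (Suc (length v))"
    by (metis length_Cons length_rotate_blocks)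
  then obtain y' x' u where v': "v' = y' # x' # u"
    by (metis length_Suc_conv)
  show ?case
  proof (cases "P x")
    case True
    with 3 v' have "rotate_blocks P (x # v) = rotate_blocks P (x' # u)" "y = y'" "P x'"
      by (auto split: if_splits)
    with True 3(1)[of "x' # u"] v' show ?thesis
      by simp
  next
    case False
    with 3 v' have "rotate_blocks P (y # v) = rotate_blocks P (y' # u)" "x = x'"
      by (auto split: if_splits)
    with False 3(2)[of "y' # u"] 3 v' show ?thesis
      by simp
  qed
qed

text \<open>Read forwards, the element \<open>y \<le> a\<close> of a block moves in front of the
  letters \<open>> a\<close> of that block. Each of these gains one pair with \<open>y\<close> and
  no other pair changes order, so \<open>winv\<close> grows by the number of letters
  \<open>> a\<close>.\<close>

lemma winv_rotate_blocks_le: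
  "v \<noteq> [] \<Longrightarrow> hd v \<le> a \<Longrightarrow>
   winv (rotate_blocks (\<lambda>x. x \<le> a) v) + count_le a v = winv v + length v"
proof (induction "\<lambda>x. x \<le> a" v rule: rotate_blocks.induct)
  case (3 y x v)
  have "count_le y (rotate_blocks (\<lambda>x. x \<le> a) (x # v)) = count_le y (x # v)"
       "count_le x (rotate_blocks (\<lambda>x. x \<le> a) (y # v)) = count_le x (y # v)"
    by (rule count_le_cong_mset; simp)+
  with 3 show ?case by auto
qed auto

text \<open>Here the element \<open>y > a\<close> of a block moves, read forwards, in front of the
  letters \<open>\<le> a\<close> of that block, and one pair is lost for each of them.\<close>

lemma winv_rotate_blocks_gr:
  "v \<noteq> [] \<Longrightarrow> \<not> hd v \<le> a \<Longrightarrow>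
   winv (rotate_blocks (\<lambda>x. \<not> x \<le> a) v) + count_le a v = winv v"
proof (induction "\<lambda>x. \<not> x \<le> a" v rule: rotate_blocks.induct)
  case (3 y x v)
  have "count_le y (rotate_blocks (\<lambda>x. \<not> x \<le> a) (x # v)) = count_le y (x # v)"
       "count_le x (rotate_blocks (\<lambda>x. \<not> x \<le> a) (y # v)) = count_le x (y # v)"
    by (rule count_le_cong_mset; simp)+
  with 3 show ?case by auto
qed auto

text \<open>The letter \<open>0\<close> adds nothing to either statistic, so no correction is made
  for it. The unspecified \<open>hd []\<close> is harmless because both rotations fix
  \<open>[]\<close>.\<close>

definition foata_step :: "nat \<Rightarrow> nat list \<Rightarrow> nat list" where
  "foata_step a v =
     (if a = 0 then v
      else if hd v \<le> a then rotate_blocks (\<lambda>x. x \<le> a) v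
      else rotate_blocks (\<lambda>x. \<not> x \<le> a) v)"

lemma mset_foata_step [simp]: "mset (foata_step a v) = mset v"
  by (simp add: foata_step_def)

text \<open>The term \<open>count_le a v\<close> is what \<open>a\<close> itself adds to
  \<open>winv\<close> once it is put in front. The total gain is then exactly the new summand of
  \<open>wmaj\<close>.\<close>

lemma winv_foata_step:
  "0 < a \<Longrightarrow> winv (foata_step a v) + count_le a v =
     winv v + (if v \<noteq> [] \<and> hd v \<le> a then length v else 0)"
  using winv_rotate_blocks_le[of v a] winv_rotate_blocks_gr[of v a]
  by (cases "v = []") (auto simp: foata_step_def)

lemma foata_step_inject:
  assumes "foata_step a v = foata_step a v'"
  shows "v = v'"
proof (cases "a = 0 \<or> v = [] \<or> v' = []")
  case True
  have "length v = length v'"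
    using assms by (metis mset_foata_step size_mset)
  with True assms show ?thesis
    by (auto simp: foata_step_def)
next
  case False
  have "last (foata_step a u) \<le> a \<longleftrightarrow> hd u \<le> a" if "u \<noteq> []" for u
    using False that last_rotate_blocks[of u "\<lambda>x. x \<le> a"]
      last_rotate_blocks[of u "\<lambda>x. \<not> x \<le> a"]
    by (auto simp: foata_step_def)
  then have "hd v \<le> a \<longleftrightarrow> hd v' \<le> a"
    using False assms by metis
  with False assms show ?thesis
    using rotate_blocks_inject[of "\<lambda>x. x \<le> a" v v']
      rotate_blocks_inject[of "\<lambda>x. \<not> x \<le> a" v v']
    by (auto simp: foata_step_def split: if_splits)
qed

fun foata :: "nat list \<Rightarrow> nat list" where
  "foata [] = []"
| "foata (a # w) = a # foata_step a (foata w)"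

lemma mset_foata [simp]: "mset (foata w) = mset w"
  by (induction w) auto

lemma length_foata [simp]: "length (foata w) = length w"
  by (metis mset_foata size_mset)

lemma set_foata [simp]: "set (foata w) = set w"
  by (metis mset_foata set_mset_mset)

lemma hd_foata [simp]: "w \<noteq> [] \<Longrightarrow> hd (foata w) = hd w"
  by (cases w) auto

lemma foata_eq_Nil [simp]: "foata w = [] \<longleftrightarrow> w = []"
  by (metis length_0_conv length_foata)

lemma winv_foata: "winv (foata w) = wmaj w"
proof (induction w)
  case (Cons a w)
  have "count_le a (foata_step a (foata w)) = count_le a (foata w)"
    by (rule count_le_cong_mset) simp
  with Cons show ?case
    using winv_foata_step[of a "foata w"] by (auto simp: foata_step_def split: if_splits)
qed simp

lemma foata_inject: "foata v = foata w \<Longrightarrow> v = w"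
proof (induction v arbitrary: w)
  case Nil
  then show ?case by (metis foata_eq_Nil foata.simps(1))
next
  case (Cons a v)
  then obtain b w' where "w = b # w'"
    by (metis foata_eq_Nil list.exhaust)
  with Cons show ?case
    by (auto dest: foata_step_inject)
qed

text \<open>A nonzero head selects one representative among the words that differ only by
  insignificant zeros.\<close>

definition words :: "nat \<Rightarrow> nat list set" where
  "words m = {w. set w \<subseteq> {..m} \<and> (w \<noteq> [] \<longrightarrow> hd w \<noteq> 0)}"

text \<open>Surjectivity comes from injectivity, since \<open>foata\<close> maps the finite set of
  words of a fixed length into itself.\<close>

lemma bij_betw_foata: "bij_betw foata (words m) (words m)"
proof -
  have inj: "inj_on foata A" for A
    by (auto intro: inj_onI foata_inject)
  have "foata ` words m = words m"
  proof
    show "foata ` words m \<subseteq> words m"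
      by (auto simp: words_def)
    show "words m \<subseteq> foata ` words m"
    proof
      fix w assume w: "w \<in> words m"
      define X where "X = {v \<in> words m. length v = length w}"
      have "X \<subseteq> {v. set v \<subseteq> {..m} \<and> length v = length w}"
        by (auto simp: X_def words_def)
      then have "finite X"
        using finite_lists_length_eq[of "{..m}"] finite_subset by blast
      moreover have "foata ` X \<subseteq> X"
        by (auto simp: X_def words_def)
      ultimately have "foata ` X = X"
        using inj by (metis endo_inj_surj)
      with w show "w \<in> foata ` words m"
        by (auto simp: X_def)
    qed
  qed
  with inj show ?thesis
    by (simp add: bij_betw_def)
qed

section \<open>Ranked letters of a word\<close>

fun ranked :: "nat list \<Rightarrow> (nat \<times> nat) set" where
  "ranked [] = {}"
| "ranked (a # w) = (if a = 0 then ranked w else insert (count_le a w, a) (ranked w))"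

lemma finite_ranked [simp]: "finite (ranked w)"
  by (induction w) auto

lemma snd_ranked: "snd ` ranked w = set w - {0}"
  by (induction w) auto

text \<open>The recorded letter is itself counted on the right. Consequently equal letters have
  distinct ranks, and the set loses no multiplicity.\<close>

lemma ranked_less: "(k, a) \<in> ranked w \<Longrightarrow> k < count_le a w"
  by (induction w) (auto split: if_splits)

lemma ranked_append: "ranked v \<subseteq> ranked (w @ v)"
  by (induction w) auto

lemma ranked_mem: "0 < a \<Longrightarrow> (count_le a w, a) \<in> ranked (v @ a # w)"
  using ranked_append[of "a # w" v] by auto

lemma ranked_append_notin: "(k, a) \<in> ranked (v @ w) \<Longrightarrow> a \<notin> set v \<Longrightarrow> (k, a) \<in> ranked w"
  by (induction v) (auto split: if_splits)

text \<open>The letters of \<open>v\<close> come later but are smaller than \<open>a\<close>, so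
  their ranks ignore it; all letters of \<open>w\<close> come earlier and count for the rank of
  \<open>a\<close>.\<close>

lemma ranked_insert:
  assumes "\<forall>x\<in>set v. x < a" "\<forall>y\<in>set w. y \<le> a" "0 < a"
  shows "ranked (v @ a # w) = insert (length w, a) (ranked (v @ w))"
  using assms by (induction v) (auto simp: count_le_eq_length)

lemma ranked_replicate_0 [simp]: "ranked (replicate n 0 @ w) = ranked w"
  by (induction n) auto

section \<open>Words and finite sets of ranked letters\<close>

text \<open>The latest occurrence of the largest letter \<open>a\<close> has all earlier letters
  counted in its rank, which is the largest rank paired with \<open>a\<close>. The set therefore
  reveals where this letter stands; it is deleted and induction applies.\<close>

lemma ranked_inject:
  assumes "length v = length w" "ranked v = ranked w"
  shows "v = w"
  using assms
proof (induction "length v" arbitrary: v w rule: less_induct)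
  case less
  show ?case
  proof (cases "set v \<subseteq> {0}")
    case True
    moreover have "set v - {0} = set w - {0}"
      unfolding snd_ranked[symmetric] less.prems(2) ..
    ultimately have "x = 0" if "x \<in> set v \<union> set w" for x
      using that by blast
    then have "v = replicate (length v) 0" "w = replicate (length w) 0"
      by (auto intro: replicate_eqI)
    with less.prems(1) show ?thesis
      by simp
  next
    case False
    have *: "\<exists>x y. u = x @ a # y \<and> ranked u = insert (length y, a) (ranked (x @ y)) \<and>
             (\<forall>k. (k, a) \<in> ranked (x @ y) \<longrightarrow> k < length y)"
      if "a = Max (set u - {0})" "set u - {0} \<noteq> {}" for a and u :: "nat list"
    proof -
      have "a \<in> set u - {0}"
        unfolding that(1) by (rule Max_in) (use that(2) in auto)
      have mx: "x \<le> a" if "x \<in> set u" for x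
        using that Max_ge[of "set u - {0}" x] unfolding \<open>a = Max (set u - {0})\<close>
        by (cases "x = 0") auto
      then obtain x y where u: "u = x @ a # y" "a \<notin> set x"
        using split_list_first[of a u] \<open>a \<in> set u - {0}\<close> by blast
      have "ranked u = insert (length y, a) (ranked (x @ y))"
        unfolding u(1)
      proof (rule ranked_insert)
        show "\<forall>z\<in>set x. z < a"
        proof
          fix z assume "z \<in> set x"
          with u mx[of z] show "z < a"
            by (cases "z = a") auto
        qed
      qed (use u(1) mx \<open>a \<in> set u - {0}\<close> in simp_all)
      moreover have "k < length y" if "(k, a) \<in> ranked (x @ y)" for k
        using ranked_less[OF ranked_append_notin[OF that u(2)]] length_filter_le[of "\<lambda>x. x \<le> a" y]
        unfolding count_le_def by linarith
      ultimately show ?thesis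
        using u(1) by blast
    qed
    define a where "a = Max (set v - {0})"
    have eq: "set v - {0} = set w - {0}"
      unfolding snd_ranked[symmetric] less.prems(2) ..
    have ne: "set v - {0} \<noteq> {}"
      using False by auto
    from *[OF a_def ne] obtain x y where v: "v = x @ a # y" "ranked v = insert (length y, a) (ranked (x @ y))"
        "\<forall>k. (k, a) \<in> ranked (x @ y) \<longrightarrow> k < length y"
      by (elim exE conjE)
    have a_w: "a = Max (set w - {0})" and ne': "set w - {0} \<noteq> {}"
      using a_def eq ne by simp_all
    from *[OF a_w ne'] obtain x' y' where w: "w = x' @ a # y'" "ranked w = insert (length y', a) (ranked (x' @ y'))"
        "\<forall>k. (k, a) \<in> ranked (x' @ y') \<longrightarrow> k < length y'"
      by (elim exE conjE)
    have eq': "insert (length y, a) (ranked (x @ y)) = insert (length y', a) (ranked (x' @ y'))"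
      using v(2) w(2) less.prems(2) by simp
    \<comment> \<open>If the ranks differed, each pair would lie in the remainder of the other word,
      and each rank would be smaller than the other.\<close>
    have len: "length y = length y'"
    proof (rule ccontr)
      assume "length y \<noteq> length y'"
      then have "(length y, a) \<in> ranked (x' @ y')" "(length y', a) \<in> ranked (x @ y)"
        using equalityD1[OF eq'] equalityD2[OF eq'] by auto
      with v(3) w(3) show False
        using less_asym by blast
    qed
    have "(length y, a) \<notin> ranked (x @ y)" "(length y', a) \<notin> ranked (x' @ y')"
      using v(3)[rule_format, of "length y"] w(3)[rule_format, of "length y'"] by auto
    with eq' len have "ranked (x @ y) = ranked (x' @ y')"
      by (metis insert_ident)
    then have "x @ y = x' @ y'"
      using less.hyps[of "x @ y" "x' @ y'"] v(1) w(1) less.prems(1) by simp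
    with len v(1) w(1) show ?thesis
      by simp
  qed
qed

text \<open>The deletion used for injectivity is reversed: the largest letter with its largest rank
  is taken out of \<open>T\<close> and inserted into a word for the rest.\<close>

lemma ranked_surj:
  assumes "finite T" "0 \<notin> snd ` T"
  shows "\<exists>w. ranked w = T \<and> set w \<subseteq> insert 0 (snd ` T)"
  using assms
proof (induction "card T" arbitrary: T rule: less_induct)
  case less
  show ?case
  proof (cases "T = {}")
    case True
    then show ?thesis
      by (intro exI[of _ "[]"]) simp
  next
    case False
    define a where "a = Max (snd ` T)"
    define k where "k = Max {k. (k, a) \<in> T}"
    have "a \<in> snd ` T"
      unfolding a_def using False less.prems by (intro Max_in) auto
    then have ne: "{k. (k, a) \<in> T} \<noteq> {}"
      by force
    have fin: "finite {k. (k, a) \<in> T}"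
    proof (rule finite_subset)
      show "{k. (k, a) \<in> T} \<subseteq> fst ` T"
        by force
    qed (use less.prems in simp)
    have ka: "(k, a) \<in> T"
      using Max_in[OF fin ne] by (simp add: k_def)
    have a0: "0 < a"
      using \<open>a \<in> snd ` T\<close> less.prems(2) by (cases a) auto
    define T' where "T' = T - {(k, a)}"
    have "card T' < card T"
      unfolding T'_def using less.prems(1) ka by (rule card_Diff1_less)
    then obtain w where w: "ranked w = T'" "set w \<subseteq> insert 0 (snd ` T')"
      using less.hyps[of T'] less.prems by (auto simp: T'_def)
    \<comment> \<open>The padding guarantees a place with exactly \<open>k\<close> letters before
      it; these letters will form \<open>y\<close>.\<close>
    define u where "u = replicate k 0 @ w"
    have u: "ranked u = T'" "set u \<subseteq> insert 0 (snd ` T')"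
      using w by (auto simp: u_def)
    have le: "\<forall>x\<in>set u. x \<le> a"
    proof
      fix x assume "x \<in> set u"
      then have "x = 0 \<or> x \<in> snd ` T"
        using u(2) by (auto simp: T'_def)
      then show "x \<le> a"
        using less.prems(1) Max_ge[of "snd ` T" x] unfolding a_def by blast
    qed
    define x where "x = take (length u - k) u"
    define y where "y = drop (length u - k) u"
    have xy: "u = x @ y" "length y = k"
      unfolding x_def y_def by (rule append_take_drop_id[symmetric], simp add: u_def)
    \<comment> \<open>Another \<open>a\<close> behind that place would have a rank in
      \<open>T'\<close> of at least \<open>k\<close>, against the maximality of
      \<open>k\<close>.\<close>
    have "a \<notin> set x"
    proof
      assume "a \<in> set x"
      then obtain p q where "x = p @ a # q"
        by (meson split_list)
      then have u': "u = p @ a # (q @ y)"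
        using xy by simp
      then have "(length (q @ y), a) \<in> T'"
      proof -
        have "count_le a (q @ y) = length (q @ y)"
          by (rule count_le_eq_length) (use le u' in simp)
        then show ?thesis
          using ranked_mem[OF a0, of "q @ y" p] unfolding u'[symmetric] u(1) by simp
      qed
      then have "length (q @ y) \<in> {k. (k, a) \<in> T}" "length (q @ y) \<noteq> k"
        by (auto simp: T'_def)
      then show False
        using Max_ge[OF fin] xy(2) unfolding k_def[symmetric]
        by (metis le_add2 le_antisym length_append)
    qed
    have "z < a" if "z \<in> set x" for z
      using that le[rule_format, of z] xy(1) \<open>a \<notin> set x\<close> by (cases "z = a") auto
    then have "ranked (x @ a # y) = insert (k, a) T'"
      using ranked_insert[of x a y] le xy u(1) a0 by auto
    then have "ranked (x @ a # y) = T"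
      using ka by (auto simp: T'_def)
    moreover have "set (x @ a # y) \<subseteq> insert 0 (snd ` T)"
      using u(2) \<open>a \<in> snd ` T\<close> xy(1) by (auto simp: T'_def)
    ultimately show ?thesis
      by blast
  qed
qed

section \<open>Over-partitions\<close>

abbreviation ntimes :: "nat \<Rightarrow> 'a::comm_monoid_add \<Rightarrow> 'a" where
  "ntimes n x \<equiv> (\<Sum>_<n. x)"

lemma ntimes_add: "ntimes (a + b) x = ntimes a x + ntimes b x"
  by (induction b) (simp_all add: ac_simps)

lemma ntimes_sum: "ntimes n (\<Sum>i\<in>A. f i) = (\<Sum>i\<in>A. ntimes n (f i))"
  by (rule sum.swap)

lemma psize_eq_0_iff: "p \<noteq> Overlined 0 \<Longrightarrow> psize p = 0 \<longleftrightarrow> p = Plain 0"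
  by (cases p) auto

lemma S_weight_eq:
  assumes "\<And>i. i > n \<Longrightarrow> l i = Plain 0"
  shows "S_weight s l = (\<Sum>i=1..n. ntimes (psize (l i)) (s i))"
  unfolding S_weight_def
proof (rule sum.mono_neutral_left)
  show "{i. 1 \<le> i \<and> l i \<noteq> Plain 0} \<subseteq> {1..n}"
    using assms by (metis (mono_tags, lifting) atLeastAtMost_iff mem_Collect_eq not_le subsetI)
qed auto

text \<open>
  The conditions on an over-partition that compare neighbouring parts only: uniqueness of
  over-lined parts becomes the strict decrease after an over-lined part.
\<close>

definition drops :: "(nat \<Rightarrow> opart) \<Rightarrow> nat \<Rightarrow> bool" where
  "drops l i \<longleftrightarrow> psize (l (i + 1)) + of_bool (is_overlined (l i)) \<le> psize (l i)"

lemma psize_mono: "p \<le> q \<Longrightarrow> psize p \<le> psize q"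
  by (auto simp: less_eq_opart_def)

lemma antimono_parts:
  fixes l :: "nat \<Rightarrow> opart"
  assumes "\<And>i. i \<ge> 1 \<Longrightarrow> l (i + 1) \<le> l i" "1 \<le> i" "i \<le> j"
  shows "l j \<le> l i"
  using assms(3) by (induction j rule: dec_induct) (use assms in \<open>auto intro: order_trans\<close>)

lemma drops_iff:
  assumes "l i \<noteq> Overlined 0"
  shows "drops l i \<longleftrightarrow> l (i + 1) \<le> l i \<and> \<not> (is_overlined (l i) \<and> l (i + 1) = l i)"
  by (cases "l i"; cases "l (i + 1)") (auto simp: drops_def less_eq_opart_def)

text \<open>Conversely, an over-lined part cannot recur, because the size falls strictly right after
  it and never rises again.\<close>

lemma overpartition_iff:
  "overpartition l \<longleftrightarrow> l 0 = Plain 0 \<and> (\<forall>i. l i \<noteq> Overlined 0) \<and> (\<forall>i\<ge>1. drops l i) \<and>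
     (\<exists>n. \<forall>i>n. l i = Plain 0)" (is "_ \<longleftrightarrow> ?R")
proof
  assume l: "overpartition l"
  have "drops l i" if "i \<ge> 1" for i
  proof -
    have "\<not> (is_overlined (l i) \<and> l (i + 1) = l i)"
    proof
      assume a: "is_overlined (l i) \<and> l (i + 1) = l i"
      then obtain k where "l i = Overlined k" by (cases "l i") auto
      then have "i + 1 = i"
        using l that a unfolding overpartition_def by (metis le_add2)
      then show False by simp
    qed
    with l that show ?thesis
      by (subst drops_iff) (auto simp: overpartition_def)
  qed
  moreover have "\<exists>n. \<forall>i>n. l i = Plain 0"
  proof -
    have "finite {i. i \<ge> 1 \<and> l i \<noteq> Plain 0}"
      using l by (simp add: overpartition_def)
    then obtain n where "\<forall>i\<in>{i. i \<ge> 1 \<and> l i \<noteq> Plain 0}. i \<le> n"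
      using finite_nat_set_iff_bounded_le by auto
    then show ?thesis
      by (intro exI[of _ n]) (metis (mono_tags, lifting) mem_Collect_eq le0 le_less_trans less_one
          not_le)
  qed
  ultimately show ?R
    using l by (auto simp: overpartition_def)
next
  assume l: ?R
  then have dec: "l (i + 1) \<le> l i" if "i \<ge> 1" for i
    using that by (metis drops_iff)
  have uniq: "\<not> j > i" if "i \<ge> 1" "l i = Overlined k" "l j = Overlined k" for i j k
  proof
    assume "j > i"
    then have "l j \<le> l (i + 1)"
      using antimono_parts[of l "i + 1" j] dec by simp
    moreover have "drops l i"
      using l that by auto
    ultimately show False
      using that psize_mono[of "l j" "l (i + 1)"] by (simp add: drops_def)
  qed
  obtain n where "\<forall>i>n. l i = Plain 0"
    using l by blast
  then have "{i. i \<ge> 1 \<and> l i \<noteq> Plain 0} \<subseteq> {..n}"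
    using leI by blast
  then have "finite {i. i \<ge> 1 \<and> l i \<noteq> Plain 0}"
    by (rule finite_subset) simp
  with l dec uniq show "overpartition l"
    unfolding overpartition_def by (metis linorder_neqE_nat)
qed

lemma overpartition_mono:
  assumes "overpartition l" "1 \<le> i" "i \<le> j"
  shows "l j \<le> l i"
  using antimono_parts[of l i j] assms by (auto simp: overpartition_def)

lemma overpartition_drops: "overpartition l \<Longrightarrow> 1 \<le> i \<Longrightarrow> drops l i"
  by (simp add: overpartition_iff)

section \<open>Local descriptions of \<open>Fbar_m\<close> and \<open>Fbar\<close>\<close>

text \<open>By monotonicity the positions of \<open>Plain v\<close> form an interval, so there are
  at least \<open>m\<close> of them exactly when two are \<open>m - 1\<close> apart.\<close>

lemma plain_run_iff:
  assumes l: "overpartition l" and "m \<ge> 1" "v \<ge> 1"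
  shows "card {i. i \<ge> 1 \<and> l i = Plain v} < m \<longleftrightarrow>
         (\<forall>i\<ge>1. \<not> (l i = Plain v \<and> l (i + m - 1) = Plain v))"
proof -
  define X where "X = {i. i \<ge> 1 \<and> l i = Plain v}"
  have "X \<subseteq> {i. i \<ge> 1 \<and> l i \<noteq> Plain 0}"
    using assms(3) by (auto simp: X_def)
  then have fin: "finite X"
    using l by (auto simp: overpartition_def intro: finite_subset)
  have conv: "k \<in> X" if "i \<in> X" "j \<in> X" "i \<le> k" "k \<le> j" for i j k
  proof -
    have "l k \<le> l i" "l j \<le> l k" "k \<ge> 1"
      using that overpartition_mono[OF l, of i k] overpartition_mono[OF l, of k j]
      by (simp_all add: X_def)
    with that show ?thesis
      by (simp add: X_def)
  qed
  have "card X < m \<longleftrightarrow> (\<forall>i. \<not> (i \<in> X \<and> i + m - 1 \<in> X))"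
  proof
    assume "card X < m"
    show "\<forall>i. \<not> (i \<in> X \<and> i + m - 1 \<in> X)"
    proof (intro allI notI)
      fix i assume "i \<in> X \<and> i + m - 1 \<in> X"
      then have "{i..i + m - 1} \<subseteq> X"
        using conv[of i "i + m - 1"] by (meson atLeastAtMost_iff subsetI)
      then have "card {i..i + m - 1} \<le> card X"
        by (rule card_mono[OF fin])
      with \<open>card X < m\<close> assms(2) show False
        by simp
    qed
  next
    assume R: "\<forall>i. \<not> (i \<in> X \<and> i + m - 1 \<in> X)"
    show "card X < m"
    proof (cases "X = {}")
      case True
      with assms(2) show ?thesis by simp
    next
      case False
      have mem: "Min X \<in> X" "Max X \<in> X"
        using fin False Min_in Max_in by blast+
      have "Max X < Min X + m - 1"
      proof (rule ccontr)
        assume "\<not> ?thesis"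
        then have "Min X + m - 1 \<in> X"
          using conv[OF mem, of "Min X + m - 1"] assms(2) by simp
        with R mem show False by blast
      qed
      moreover have "X \<subseteq> {Min X..Max X}"
        using fin Min_le Max_ge by (meson atLeastAtMost_iff subsetI)
      then have "card X \<le> card {Min X..Max X}"
        by (intro card_mono) auto
      ultimately show ?thesis
        using assms(2) by simp
    qed
  qed
  moreover have "i \<in> X \<and> i + m - 1 \<in> X \<longleftrightarrow> i \<ge> 1 \<and> l i = Plain v \<and> l (i + m - 1) = Plain v" for i
    using assms(2) by (auto simp: X_def)
  ultimately show ?thesis
    unfolding X_def[symmetric] by blast
qed

lemma Fbar_m_iff:
  assumes "m \<ge> 1"
  shows "l \<in> Fbar_m m \<longleftrightarrow> overpartition l \<and>
    (\<forall>v\<ge>1. \<forall>i\<ge>1. \<not> (l i = Plain v \<and> l (i + m - 1) = Plain v)) \<and>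
    (\<forall>i\<ge>1. \<not> m dvd i \<longrightarrow> psize (l i) = psize (l (i + 1)) + of_bool (is_overlined (l i)))"
proof -
  have *: "int (psize (l i)) - int (psize (l (i + 1))) = of_bool (is_overlined (l i)) \<longleftrightarrow>
    psize (l i) = psize (l (i + 1)) + of_bool (is_overlined (l i))" for i
    by (auto split: if_splits)
  show ?thesis
    using plain_run_iff[of l m] assms unfolding Fbar_m_def mem_Collect_eq * by blast
qed

lemma Fbar_iff:
  "l \<in> Fbar \<longleftrightarrow> overpartition l \<and>
    (\<forall>i\<ge>1. psize (l i) = psize (l (i + 1)) + of_bool (is_overlined (l i)))"
proof (cases "overpartition l")
  case l: True
  show ?thesis
  proof
    assume F: "l \<in> Fbar"
    show "overpartition l \<and>
      (\<forall>i\<ge>1. psize (l i) = psize (l (i + 1)) + of_bool (is_overlined (l i)))"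
    proof (intro conjI l allI impI, rule ccontr)
      fix i :: nat assume i: "i \<ge> 1"
      \<comment> \<open>If the size falls too much at \<open>i\<close>, then
        \<open>Overlined k\<close> lies strictly between \<open>l (i + 1)\<close> and
        \<open>l i\<close> and hence is not a part.\<close>
      define k where "k = psize (l (i + 1)) + 1"
      assume "psize (l i) \<noteq> psize (l (i + 1)) + of_bool (is_overlined (l i))"
      then have "psize (l i) > psize (l (i + 1)) + of_bool (is_overlined (l i))"
        using overpartition_drops[OF l i] by (simp add: drops_def)
      then have less: "Overlined k < l i" "l (i + 1) < Overlined k"
        by (auto simp: less_opart_def k_def split: if_splits)
      moreover have "l i \<le> l 1"
        using overpartition_mono[OF l, of 1 i] i by simp
      ultimately have "Overlined k \<le> l 1"
        by order
      then obtain j where j: "j \<ge> 1" "l j = Overlined k"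
        using F by (auto simp: Fbar_def k_def)
      show False
      proof (cases "j \<le> i")
        case True
        with j less overpartition_mono[OF l, of j i] show ?thesis
          by auto
      next
        case False
        with j less overpartition_mono[OF l, of "i + 1" j] show ?thesis
          by auto
      qed
    qed
  next
    assume R: "overpartition l \<and>
      (\<forall>i\<ge>1. psize (l i) = psize (l (i + 1)) + of_bool (is_overlined (l i)))"
    have "\<exists>i\<ge>1. l i = Overlined k" if k: "k \<ge> 1" "Overlined k \<le> l 1" for k
    proof -
      obtain n where n: "\<forall>i>n. l i = Plain 0"
        using l by (auto simp: overpartition_iff)
      \<comment> \<open>The last part of size at least \<open>k\<close> must be
        \<open>Overlined k\<close>, since the next size is below \<open>k\<close> and falls by at
        most one, only after an over-lined part.\<close>
      define X where "X = {i. i \<ge> 1 \<and> k \<le> psize (l i)}"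
      have "X \<subseteq> {..n}"
        using n k by (auto simp: X_def intro: leI)
      then have fin: "finite X"
        by (rule finite_subset) simp
      have "1 \<in> X"
        using k by (auto simp: X_def less_eq_opart_def)
      then have mx: "Max X \<in> X"
        using fin Max_in by blast
      have "Max X + 1 \<notin> X"
        using fin Max_ge[of X "Max X + 1"] by linarith
      then have "psize (l (Max X + 1)) < k" "k \<le> psize (l (Max X))" "Max X \<ge> 1"
        using mx by (auto simp: X_def)
      moreover have "psize (l (Max X)) = psize (l (Max X + 1)) + of_bool (is_overlined (l (Max X)))"
        using R \<open>Max X \<ge> 1\<close> by blast
      ultimately have "l (Max X) = Overlined k"
        by (cases "l (Max X)") auto
      with \<open>Max X \<ge> 1\<close> show ?thesis
        by blast
    qed
    with l show "l \<in> Fbar"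
      by (auto simp: Fbar_def)
  qed
qed (simp add: Fbar_def)

section \<open>Words and \<open>Fbar_m\<close>\<close>

text \<open>
  The new largest over-lined part \<open>Overlined (length w + 1)\<close> goes to position \<open>a\<close>. If \<open>a < hd w\<close>, the
  position is free and only the parts up to it grow; otherwise all parts move by a full period.
\<close>

fun word_parts :: "nat \<Rightarrow> nat list \<Rightarrow> nat \<Rightarrow> opart" where
  "word_parts m [] = (\<lambda>_. Plain 0)"
| "word_parts m (a # w) =
     (if a = 0 then word_parts m w
      else (\<lambda>i. if i = 0 then Plain 0
                else if i < a then Plain (Suc (length w))
                else if i = a then Overlined (Suc (length w))
                else if w \<noteq> [] \<and> a < hd w then word_parts m w i
                else if i \<le> m then Plain (length w)
                else word_parts m w (i - m)))"

lemma word_parts_0 [simp]: "word_parts m w 0 = Plain 0"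
  by (induction w) auto

lemma psize_word_parts_le: "psize (word_parts m w i) \<le> length w"
  by (induction w arbitrary: i) (auto intro: le_SucI)

lemma word_parts_neq_Overlined_0: "word_parts m w i \<noteq> Overlined 0"
  by (induction w arbitrary: i) auto

lemma word_parts_support: "i > m * length w \<Longrightarrow> set w \<subseteq> {..m} \<Longrightarrow> word_parts m w i = Plain 0"
proof (induction w arbitrary: i)
  case (Cons a w)
  then have "word_parts m w i = Plain 0" "word_parts m w (i - m) = Plain 0" if "i > m"
    by (auto intro!: Cons.IH)
  with Cons.prems show ?case
    by auto
qed simp

lemma word_parts_less_hd: "w \<noteq> [] \<Longrightarrow> 1 \<le> i \<Longrightarrow> i < hd w \<Longrightarrow> word_parts m w i = Plain (length w)"
  by (cases w) auto

lemma word_parts_hd: "w \<noteq> [] \<Longrightarrow> hd w \<noteq> 0 \<Longrightarrow> word_parts m w (hd w) = Overlined (length w)"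
  by (cases w) auto

lemma psize_word_parts_less:
  assumes "w \<noteq> []" "hd w < i" "m > 0"
  shows "psize (word_parts m w i) < length w"
  using assms psize_word_parts_le[of m "tl w"] by (cases w) (auto simp: less_Suc_eq_le)

text \<open>This makes the last letter visible in the sequence: it is the position of the over-lined
  part of size \<open>length w\<close>, and \<open>0\<close> if that part is absent.\<close>

lemma word_parts_eq_Overlined_length:
  assumes "word_parts m w i = Overlined (length w)" "m > 0"
  shows "w \<noteq> [] \<and> hd w \<noteq> 0 \<and> i = hd w"
proof -
  have w: "w \<noteq> []" using assms by auto
  moreover have "hd w \<ge> i"
    using psize_word_parts_less[OF w _ assms(2), of i] assms(1) by (metis leI less_irrefl opart.sel(2))
  moreover have "i \<noteq> 0"
    using assms by (metis word_parts_0 opart.distinct(1))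
  ultimately show ?thesis
    using word_parts_less_hd[OF w, of i m] assms by (cases "i = hd w") auto
qed

lemma word_parts_in_Fbar_m:
  assumes "m \<ge> 1" "set w \<subseteq> {..m}"
  shows "word_parts m w \<in> Fbar_m m"
proof -
  have "(\<forall>i\<ge>1. drops (word_parts m w) i) \<and>
    (\<forall>v\<ge>1. \<forall>i\<ge>1. \<not> (word_parts m w i = Plain v \<and> word_parts m w (i + m - 1) = Plain v)) \<and>
    (\<forall>i\<ge>1. \<not> m dvd i \<longrightarrow>
      psize (word_parts m w i) = psize (word_parts m w (i + 1)) + of_bool (is_overlined (word_parts m w i)))"
    using assms(2)
  proof (induction w)
    case Nil
    show ?case by (auto simp: drops_def)
  next
    case (Cons a w)
    define x where "x = length w"
    have IH1: "drops (word_parts m w) i" if "i \<ge> 1" for i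
      using Cons that by auto
    have IH2: "\<not> (word_parts m w i = Plain v \<and> word_parts m w (i + m - 1) = Plain v)" if "i \<ge> 1" "v \<ge> 1" for i v
      using Cons that by auto
    have IH3: "psize (word_parts m w i) = psize (word_parts m w (i + 1)) + of_bool (is_overlined (word_parts m w i))"
      if "i \<ge> 1" "\<not> m dvd i" for i
      using Cons that by auto
    show ?case
    proof (cases "a = 0")
      case True
      with IH1 IH2 IH3 show ?thesis by simp
    next
      case a: False
      have am: "a \<le> m" using Cons.prems by simp
      define l where "l = word_parts m (a # w)"
      have less: "l i = Plain (Suc x)" if "1 \<le> i" "i < a" for i
        using that a by (simp add: l_def x_def)
      have at: "l a = Overlined (Suc x)"
        using a by (simp add: l_def x_def)
      have gr: "psize (l i) \<le> x" if "a < i" for i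
        using psize_word_parts_less[of "a # w" i m] that assms(1) by (simp add: l_def x_def)
      \<comment> \<open>Needed at the seam of the shift: a run of \<open>m\<close> parts
        \<open>Plain x\<close> starting at \<open>i\<close> with \<open>a < i \<le> m\<close> would
        end in the old sequence at \<open>i - 1 \<ge> a\<close>.\<close>
      have below: "word_parts m w i \<noteq> Plain x" if "w = [] \<or> hd w \<le> a" "a \<le> i" "x \<ge> 1" for i
      proof -
        have w: "w \<noteq> []" using that x_def by auto
        show ?thesis
        proof (cases "i = hd w")
          case True
          with a w word_parts_hd[of w m] that show ?thesis by auto
        next
          case False
          then show ?thesis
            using psize_word_parts_less[OF w, of i m] that w assms(1) by (auto simp: x_def)
        qed
      qed
      have D: "drops l i" if i: "i \<ge> 1" for i
      proof (cases "i \<le> a")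
        case True
        show ?thesis
        proof (cases "i = a")
          case True
          with at gr[of "a + 1"] show ?thesis
            by (auto simp: drops_def)
        next
          case False
          with True i less[of i] less[of "i + 1"] at show ?thesis
            by (cases "i + 1 = a") (auto simp: drops_def)
        qed
      next
        case False
        \<comment> \<open>At \<open>i = m\<close> in the shifted branch the next part is the first
          old one, of size at most \<open>x\<close>.\<close>
        with IH1[of i] IH1[of "i - m"] i psize_word_parts_le[of m w 1] am a show ?thesis
          by (cases "i = m") (auto simp: drops_def l_def Suc_diff_le)
      qed
      moreover have "\<not> (l i = Plain v \<and> l (i + m - 1) = Plain v)" if i: "i \<ge> 1" "v \<ge> 1" for i v
      proof
        assume run: "l i = Plain v \<and> l (i + m - 1) = Plain v"
        show False
        proof (cases "i \<le> a")
          case True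
          then have "i < a" using at run by (cases "i = a") auto
          then have "v = Suc x" using less[of i] i run by simp
          moreover have "i + m - 1 \<ge> a" using i am by simp
          ultimately show False
            using at gr[of "i + m - 1"] run by (cases "i + m - 1 = a") auto
        next
          case ia: False
          show False
          proof (cases "w \<noteq> [] \<and> a < hd w")
            case True
            moreover have "a < i + m - 1"
              using ia i assms(1) by linarith
            ultimately have "l (i + m - 1) = word_parts m w (i + m - 1)" "l i = word_parts m w i"
              using ia a by (simp_all add: l_def)
            with i run IH2[of i v] show False
              by simp
          next
            case False
            show False
            proof (cases "i \<le> m")
              case True
              with False ia a run have "v = x"
                by (auto simp: l_def x_def)
              moreover have "i + m - 1 > m" "i + m - 1 - m = i - 1"
                using ia a by auto
              then have "l (i + m - 1) = word_parts m w (i - 1)"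
                using False a am by (auto simp: l_def)
              ultimately show False
                using below[of "i - 1"] False le_diff_conv2[of 1 i a] ia i run by auto
            next
              case im: False
              then have "i + m - 1 - m = i - m + m - 1" "i + m - 1 > m"
                using assms(1) by auto
              then have "l (i + m - 1) = word_parts m w (i - m + m - 1)" "l i = word_parts m w (i - m)"
                using im False a am by (auto simp: l_def)
              moreover have "i - m \<ge> 1"
                using im by simp
              ultimately show False
                using IH2[of "i - m" v] run i by simp
            qed
          qed
        qed
      qed
      moreover have "psize (l i) = psize (l (i + 1)) + of_bool (is_overlined (l i))"
        if i: "i \<ge> 1" "\<not> m dvd i" for i
      proof -
        have im: "i \<noteq> m" using i by auto
        consider "i < a" | "i = a" | "i > a" by linarith
        then show ?thesis
        proof cases
          case 1
          with i less[of i] less[of "i + 1"] at show ?thesis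
            by (cases "i + 1 = a") auto
        next
          case 2
          have "psize (l (a + 1)) = x"
          proof (cases "w \<noteq> [] \<and> a < hd w")
            case True
            then have "l (a + 1) = word_parts m w (a + 1)" by (simp add: l_def)
            then show ?thesis
              using True word_parts_less_hd[of w "a + 1" m] word_parts_hd[of w m] unfolding x_def
              by (cases "a + 1 = hd w") auto
          next
            case False
            with 2 im am a show ?thesis by (auto simp: l_def x_def)
          qed
          with 2 at show ?thesis by simp
        next
          case 3
          show ?thesis
          proof (cases "w \<noteq> [] \<and> a < hd w")
            case True
            with 3 i IH3[of i] show ?thesis by (simp add: l_def)
          next
            case False
            show ?thesis
            proof (cases "i < m")
              case True
              with False 3 a show ?thesis by (auto simp: l_def)
            next
              case False
              then have "\<not> m dvd i - m" "i - m \<ge> 1"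
                using i im by (auto simp: dvd_minus_self)
              moreover have "l i = word_parts m w (i - m)" "l (i + 1) = word_parts m w (i - m + 1)"
                using False \<open>\<not> (w \<noteq> [] \<and> a < hd w)\<close> 3 im a by (auto simp: l_def Suc_diff_le)
              ultimately show ?thesis
                using IH3[of "i - m"] by simp
            qed
          qed
        qed
      qed
      ultimately show ?thesis
        unfolding l_def by blast
    qed
  qed
  moreover have "\<exists>n. \<forall>i>n. word_parts m w i = Plain 0"
    using word_parts_support assms(2) by blast
  ultimately show ?thesis
    unfolding Fbar_m_iff[OF assms(1)] overpartition_iff
    using word_parts_0[of m w] word_parts_neq_Overlined_0[of m w] by blast
qed

text \<open>As the last letter is nonzero, the over-lined part of size \<open>length w\<close>
  occurs, preceded only by plain parts of that size. Hence the image determines the length of the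
  word.\<close>

lemma psize_word_parts_1: "w \<in> words m \<Longrightarrow> psize (word_parts m w 1) = length w"
  using word_parts_less_hd[of w 1 m] word_parts_hd[of w m]
  by (cases "hd w = 1"; cases "w = []") (auto simp: words_def)

lemma word_parts_inject:
  assumes "m \<ge> 1" "word_parts m v = word_parts m w" "length v = length w" "set v \<subseteq> {..m}" "set w \<subseteq> {..m}"
  shows "v = w"
  using assms(2-)
proof (induction v arbitrary: w)
  case Nil
  then show ?case by simp
next
  case (Cons a v)
  obtain b u where w: "w = b # u" and len: "length v = length u"
    using Cons.prems(2) by (cases w) auto
  have ab: "a = b"
  proof (rule ccontr)
    assume "a \<noteq> b"
    then consider "a \<noteq> 0" | "b \<noteq> 0" by auto
    then show False
    proof cases
      case 1
      then have "word_parts m w a = Overlined (length w)"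
        using Cons.prems(1,2) by (metis word_parts_hd list.distinct(1) list.sel(1))
      then show False
        using word_parts_eq_Overlined_length[of m w a] assms(1) w \<open>a \<noteq> b\<close> by auto
    next
      case 2
      then have "word_parts m (a # v) b = Overlined (length (a # v))"
        using Cons.prems(1,2) w by (metis word_parts_hd list.distinct(1) list.sel(1))
      then show False
        using word_parts_eq_Overlined_length[of m "a # v" b] assms(1) \<open>a \<noteq> b\<close> by auto
    qed
  qed
  show ?case
  proof (cases "a = 0")
    case True
    with Cons ab w show ?thesis by auto
  next
    case a: False
    have am: "a \<le> m" using Cons.prems(3) by simp
    define l where "l = word_parts m (a # v)"
    have l: "l = word_parts m (a # u)" using Cons.prems(1) ab w by (simp add: l_def)
    \<comment> \<open>The two branches of \<open>word_parts\<close> never agree: at position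
      \<open>hd p \<le> m\<close> one has an over-lined part, the other a plain one.\<close>
    have mixed: False
      if "p \<noteq> [] \<and> a < hd p" "\<not> (q \<noteq> [] \<and> a < hd q)" "length p = length q"
        "word_parts m (a # p) = word_parts m (a # q)" "set p \<subseteq> {..m}" for p q
    proof -
      have "hd p \<le> m"
        using that(1,5) by (meson atMost_iff hd_in_set subsetD)
      have "word_parts m (a # p) (hd p) = Overlined (length p)"
        using that(1) a word_parts_hd[of p m] by auto
      moreover have "word_parts m (a # q) (hd p) = Plain (length q)"
        using that(1,2) a \<open>hd p \<le> m\<close> by auto
      ultimately show False
        using that(4) by (metis opart.distinct(1))
    qed
    have "word_parts m v = word_parts m u"
    proof (cases "v \<noteq> [] \<and> a < hd v")
      case True
      then have True': "u \<noteq> [] \<and> a < hd u"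
        using mixed[of v u] Cons.prems ab w len by auto
      show ?thesis
      proof
        fix i
        consider "i = 0" | "1 \<le> i" "i \<le> a" | "a < i" by linarith
        then show "word_parts m v i = word_parts m u i"
        proof cases
          case 2
          then show ?thesis
            using True True' len word_parts_less_hd[of v i m] word_parts_less_hd[of u i m] by simp
        next
          case 3
          then have "word_parts m (a # v) i = word_parts m v i" "word_parts m (a # u) i = word_parts m u i"
            using True True' a by simp_all
          with l show ?thesis
            by (metis l_def)
        qed simp
      qed
    next
      case False
      then have False': "\<not> (u \<noteq> [] \<and> a < hd u)"
        using mixed[of u v] Cons.prems ab w len by auto
      show ?thesis
      proof
        fix i
        have "word_parts m (a # v) (i + m) = word_parts m v i" "word_parts m (a # u) (i + m) = word_parts m u i" if "i \<noteq> 0"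
          using False False' a am that by auto
        with l show "word_parts m v i = word_parts m u i"
          by (cases "i = 0") (auto simp: l_def)
      qed
    qed
    with Cons.IH[of u] Cons.prems ab w len show ?thesis by simp
  qed
qed

lemma word_parts_replicate_0: "word_parts m (replicate n 0 @ w) = word_parts m w"
  by (induction n) auto

text \<open>The last letter is the position \<open>a\<close> of the first over-lined part. Whether
  the first period contains a second one decides which branch of \<open>word_parts\<close> is to be
  undone.\<close>

lemma word_parts_surj:
  assumes m: "m \<ge> 1" and "l \<in> Fbar_m m"
  shows "\<exists>w \<in> words m. word_parts m w = l"
  using assms(2)
proof (induction "psize (l 1)" arbitrary: l rule: less_induct)
  case less
  have F: "overpartition l" "\<And>i v. i \<ge> 1 \<Longrightarrow> v \<ge> 1 \<Longrightarrow> \<not> (l i = Plain v \<and> l (i + m - 1) = Plain v)"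
    "\<And>i. i \<ge> 1 \<Longrightarrow> \<not> m dvd i \<Longrightarrow> psize (l i) = psize (l (i + 1)) + of_bool (is_overlined (l i))"
    using less.prems Fbar_m_iff[OF m] by auto
  have l0: "l 0 = Plain 0" "\<And>i. l i \<noteq> Overlined 0"
    using F(1) by (auto simp: overpartition_def)
  obtain n where n: "\<And>i. i > n \<Longrightarrow> l i = Plain 0"
    using F(1) overpartition_iff by metis
  \<comment> \<open>No position below \<open>m\<close> is a multiple of \<open>m\<close>, so within
    the first period the size changes only after an over-lined part.\<close>
  have const: "l i = Plain v" if "psize (l j) = v" "1 \<le> j" "j \<le> i" "i \<le> m"
    "\<And>k. j \<le> k \<Longrightarrow> k \<le> i \<Longrightarrow> \<not> is_overlined (l k)" for i j v
    using that(3-)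
  proof (induction i rule: dec_induct)
    case base
    with that(1) show ?case by (cases "l j") auto
  next
    case (step i)
    have "\<not> m dvd i"
      using step that(2) by (auto dest: dvd_imp_le)
    then have "psize (l (Suc i)) = v"
      using F(3)[of i] step that(2) by auto
    moreover have "\<not> is_overlined (l (Suc i))"
      using step by simp
    ultimately show ?case
      by (cases "l (Suc i)") auto
  qed
  show ?case
  proof (cases "psize (l 1) = 0")
    case True
    have "l i = Plain 0" for i
    proof (cases "i = 0")
      case False
      then have "psize (l i) = 0"
        using psize_mono[OF overpartition_mono[OF F(1), of 1 i]] True by simp
      then show ?thesis
        using l0(2)[of i] psize_eq_0_iff by metis
    qed (use l0 in simp)
    then have "word_parts m [] = l" by auto
    then show ?thesis
      by (intro bexI[of _ "[]"]) (auto simp: words_def)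
  next
    case False
    then obtain x where x: "psize (l 1) = Suc x"
      by (cases "psize (l 1)") auto
    \<comment> \<open>Otherwise the first \<open>m\<close> parts would all be
      \<open>Plain (Suc x)\<close>, a forbidden run.\<close>
    have "\<exists>a. 1 \<le> a \<and> a \<le> m \<and> is_overlined (l a)"
    proof (rule ccontr)
      assume "\<not> ?thesis"
      then have "l 1 = Plain (Suc x)" "l m = Plain (Suc x)"
        using const[of 1 "Suc x" 1] const[of 1 "Suc x" m] x m by auto
      then show False
        using F(2)[of 1 "Suc x"] m by simp
    qed
    then obtain a where a: "1 \<le> a" "a \<le> m" "is_overlined (l a)"
        and amin: "\<And>k. k < a \<Longrightarrow> \<not> (1 \<le> k \<and> k \<le> m \<and> is_overlined (l k))"
      using exists_least_iff[of "\<lambda>a. 1 \<le> a \<and> a \<le> m \<and> is_overlined (l a)"] by blast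
    have less_a: "l i = Plain (Suc x)" if "1 \<le> i" "i < a" for i
      using const[of 1 "Suc x" i] that a(2) amin x by auto
    have "psize (l a) = Suc x"
    proof (cases "a = 1")
      case False
      then have "\<not> m dvd a - 1"
        using a by (auto dest: dvd_imp_le)
      then show ?thesis
        using F(3)[of "a - 1"] less_a[of "a - 1"] a False by simp
    qed (use x in simp)
    then have at: "l a = Overlined (Suc x)"
      using a(3) by (cases "l a") auto
    then have sa: "psize (l (a + 1)) \<le> x"
      using overpartition_drops[OF F(1) a(1)] by (simp add: drops_def)
    have gr: "psize (l i) \<le> x" if "i > a" for i
      using psize_mono[OF overpartition_mono[OF F(1), of "a + 1" i]] that sa by simp
    have sa': "psize (l (a + 1)) = x" if "a < m"
    proof -
      have "\<not> m dvd a"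
        using a that by (auto dest: dvd_imp_le)
      then show ?thesis using F(3)[of a] a at by simp
    qed
    show ?thesis
    proof (cases "\<exists>b. a < b \<and> b \<le> m \<and> is_overlined (l b)")
      case True
      then obtain b where b: "a < b" "b \<le> m" "is_overlined (l b)"
          and bmin: "\<And>k. k < b \<Longrightarrow> \<not> (a < k \<and> k \<le> m \<and> is_overlined (l k))"
        using exists_least_iff[of "\<lambda>b. a < b \<and> b \<le> m \<and> is_overlined (l b)"] by blast
      have less_b: "l i = Plain x" if "a < i" "i < b" for i
        using const[of "a + 1" x i] that b(1,2) bmin sa' by auto
      have "psize (l b) = x"
      proof (cases "b = a + 1")
        case False
        then have "\<not> m dvd b - 1"
          using b by (auto dest: dvd_imp_le)
        then show ?thesis
          using F(3)[of "b - 1"] less_b[of "b - 1"] b False by simp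
      qed (use sa' b in simp)
      then have lb: "l b = Overlined x"
        using b(3) by (cases "l b") auto
      then have "x \<ge> 1"
        using l0(2)[of b] by (cases x) auto
      \<comment> \<open>Undoes the branch without shift: the parts up to \<open>a\<close> are
        lowered to \<open>Plain x\<close>, and \<open>Overlined x\<close> at \<open>b\<close>
        becomes the largest over-lined part.\<close>
      define l' where "l' = (\<lambda>i. if i = 0 then Plain 0 else if i \<le> a then Plain x else l i)"
      have l'_less_b: "l' i = Plain x" if "1 \<le> i" "i < b" for i
        using that less_b by (auto simp: l'_def)
      have l'_ge_b: "l' i = l i" if "b \<le> i" for i
        using that b(1) by (auto simp: l'_def)
      have "l' \<in> Fbar_m m"
        unfolding Fbar_m_iff[OF m] overpartition_iff
      proof (intro conjI allI impI)
        show "l' 0 = Plain 0" "l' i \<noteq> Overlined 0" for i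
          using l0 by (auto simp: l'_def)
        show "\<exists>n. \<forall>i>n. l' i = Plain 0"
          using n by (intro exI[of _ "max n a"]) (auto simp: l'_def)
        show "drops l' i" if "1 \<le> i" for i
        proof (cases "i < b")
          case True
          with that lb l'_less_b[of i] l'_less_b[of "i + 1"] l'_ge_b[of "i + 1"] show ?thesis
            by (cases "i + 1 = b") (auto simp: drops_def)
        next
          case False
          with that l'_ge_b[of i] l'_ge_b[of "i + 1"] overpartition_drops[OF F(1), of i] show ?thesis
            by (auto simp: drops_def)
        qed
        show "psize (l' i) = psize (l' (i + 1)) + of_bool (is_overlined (l' i))"
          if "1 \<le> i" "\<not> m dvd i" for i
        proof (cases "i < b")
          case True
          with that lb l'_less_b[of i] l'_less_b[of "i + 1"] l'_ge_b[of "i + 1"] show ?thesis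
            by (cases "i + 1 = b") auto
        next
          case False
          with that l'_ge_b[of i] l'_ge_b[of "i + 1"] F(3)[of i] show ?thesis
            by auto
        qed
        show "\<not> (l' i = Plain v \<and> l' (i + m - 1) = Plain v)" if "1 \<le> v" "1 \<le> i" for v i
        proof (cases "i < b")
          case True
          have "l' (i + m - 1) \<noteq> Plain x"
          proof
            assume p: "l' (i + m - 1) = Plain x"
            have "b \<le> i + m - 1" using b that by simp
            then have "l (i + m - 1) \<le> l b" "l (i + m - 1) = Plain x"
              using overpartition_mono[OF F(1), of b] b p l'_ge_b[of "i + m - 1"] by auto
            then show False
              using lb by (simp add: less_eq_opart_def)
          qed
          with True that l'_less_b[of i] show ?thesis by auto
        next
          case False
          with that l'_ge_b[of i] l'_ge_b[of "i + m - 1"] F(2)[of i v] m show ?thesis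
            by auto
        qed
      qed
      moreover have l'1: "psize (l' 1) = x"
        using a by (simp add: l'_def)
      ultimately obtain w where w: "w \<in> words m" "word_parts m w = l'"
        using less.hyps[of l'] x by auto
      have len: "length w = x"
        using psize_word_parts_1[OF w(1)] w(2) l'1 by simp
      have hd: "w \<noteq> []" "hd w = b"
        using word_parts_eq_Overlined_length[of m w b] w(2) len lb l'_ge_b[of b] m by auto
      have "word_parts m (a # w) = l"
      proof
        fix i
        show "word_parts m (a # w) i = l i"
          using a b hd len l0 less_a[of i] at w(2) by (auto simp: l'_def)
      qed
      moreover have "a # w \<in> words m"
        using w(1) a by (auto simp: words_def)
      ultimately show ?thesis by blast
    next
      case nob: False
      have plain: "l i = Plain x" if "a < i" "i \<le> m" for i
        using const[of "a + 1" x i] that nob sa' by auto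
      \<comment> \<open>Undoes the shift by cutting off the first period.\<close>
      define l' where "l' = (\<lambda>i. if i = 0 then Plain 0 else l (i + m))"
      have "l' \<in> Fbar_m m"
        unfolding Fbar_m_iff[OF m] overpartition_iff
      proof (intro conjI allI impI)
        show "l' 0 = Plain 0" "l' i \<noteq> Overlined 0" for i
          using l0 by (auto simp: l'_def)
        show "\<exists>n. \<forall>i>n. l' i = Plain 0"
          using n by (intro exI[of _ n]) (auto simp: l'_def)
        show "drops l' i" if "1 \<le> i" for i
          using overpartition_drops[OF F(1), of "i + m"] that by (simp add: l'_def drops_def)
        show "psize (l' i) = psize (l' (i + 1)) + of_bool (is_overlined (l' i))"
          if "1 \<le> i" "\<not> m dvd i" for i
          using F(3)[of "i + m"] that by (simp add: l'_def)
        show "\<not> (l' i = Plain v \<and> l' (i + m - 1) = Plain v)" if "1 \<le> v" "1 \<le> i" for v i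
        proof -
          have "l' (i + m - 1) = l (i + m + m - 1)" "l' i = l (i + m)"
            using that m by (auto simp: l'_def)
          then show ?thesis
            using F(2)[of "i + m" v] that by simp
        qed
      qed
      moreover have l'1: "psize (l' 1) \<le> x"
        using gr[of "1 + m"] a by (simp add: l'_def)
      ultimately obtain u where u: "u \<in> words m" "word_parts m u = l'"
        using less.hyps[of l'] x by auto
      have len_u: "length u \<le> x"
        using psize_word_parts_1[OF u(1)] u(2) l'1 by simp
      \<comment> \<open>The first part of \<open>l'\<close> may be smaller than \<open>x\<close>;
        zeros then bring the word to the length \<open>x\<close> required below the new
        letter.\<close>
      define w where "w = replicate (x - length u) 0 @ u"
      have w: "word_parts m w = l'" "length w = x" "set w \<subseteq> {..m}"
        using u len_u by (auto simp: w_def word_parts_replicate_0 words_def)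
      \<comment> \<open>Otherwise \<open>Plain x\<close> would stand at both \<open>a + 1\<close>
        and \<open>a + m\<close> in \<open>l\<close>, a forbidden run.\<close>
      have hd: "\<not> (w \<noteq> [] \<and> a < hd w)"
      proof
        assume h: "w \<noteq> [] \<and> a < hd w"
        then have "hd w \<in> set w" "x \<ge> 1"
          using w(2) by (auto simp: Suc_le_eq)
        then have "hd w \<le> m"
          using w(3) by auto
        have "l' a = Plain x"
          using word_parts_less_hd[of w a m] h a w by simp
        then have "l (a + 1 + m - 1) = Plain x"
          using a by (simp add: l'_def)
        moreover have "l (a + 1) = Plain x"
          using plain[of "a + 1"] h \<open>hd w \<le> m\<close> by simp
        ultimately show False
          using F(2)[of "a + 1" x] \<open>x \<ge> 1\<close> by simp
      qed
      have "word_parts m (a # w) = l"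
      proof
        fix i
        show "word_parts m (a # w) i = l i"
          using a hd w(1,2) l0 less_a[of i] at plain[of i] by (auto simp: l'_def)
      qed
      moreover have "a # w \<in> words m"
        using w(3) a by (auto simp: words_def)
      ultimately show ?thesis by blast
    qed
  qed
qed

lemma bij_betw_word_parts:
  assumes "m \<ge> 1"
  shows "bij_betw (word_parts m) (words m) (Fbar_m m)"
  unfolding bij_betw_def
proof
  show "inj_on (word_parts m) (words m)"
  proof (rule inj_onI)
    fix v w assume *: "v \<in> words m" "w \<in> words m" "word_parts m v = word_parts m w"
    then have "length v = length w"
      using psize_word_parts_1 by metis
    with * word_parts_inject[OF assms] show "v = w"
      by (auto simp: words_def)
  qed
  show "word_parts m ` words m = Fbar_m m"
    using word_parts_in_Fbar_m[OF assms] word_parts_surj[OF assms] by (fastforce simp: words_def)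
qed

section \<open>Weights and colors\<close>

abbreviation psum :: "(nat \<Rightarrow> 'a::comm_monoid_add) \<Rightarrow> nat \<Rightarrow> 'a" where
  "psum s r \<equiv> (\<Sum>i=1..r. s i)"

lemma sum_ntimes_step:
  assumes "a \<le> n"
  shows "(\<Sum>i=1..n. ntimes (f i + of_bool (i \<le> a)) (s i)) = (\<Sum>i=1..n. ntimes (f i) (s i)) + psum s a"
proof -
  have "(\<Sum>i=1..n. ntimes (of_bool (i \<le> a)) (s i)) = (\<Sum>i=1..n. if i \<le> a then s i else 0)"
    by (rule sum.cong) auto
  also have "\<dots> = psum s a"
    by (rule sum.mono_neutral_cong_right) (use assms in auto)
  finally show ?thesis
    by (simp add: ntimes_add sum.distrib)
qed

text \<open>Each nonzero letter \<open>a\<close> raises the parts up to \<open>a\<close>, adding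
  \<open>psum s a\<close>. The shifting branch also inserts a period of parts of size
  \<open>length w\<close>, precisely when \<open>wmaj\<close> grows by
  \<open>length w\<close>.\<close>

lemma S_weight_word_parts:
  fixes s :: "nat \<Rightarrow> 'a::comm_monoid_add"
  assumes "\<And>i. i \<ge> 1 \<Longrightarrow> s (i + m) = s i" "set w \<subseteq> {..m}"
  shows "S_weight s (word_parts m w) = (\<Sum>a\<in>#mset w. psum s a) + ntimes (wmaj w) (psum s m)"
  using assms(2)
proof (induction w)
  case Nil
  show ?case by (simp add: S_weight_def)
next
  case (Cons a w)
  define x n where "x = length w" and "n = m * length w"
  have w: "set w \<subseteq> {..m}" and am: "a \<le> m" using Cons.prems by auto
  have Sw: "S_weight s (word_parts m w) = (\<Sum>i=1..N. ntimes (psize (word_parts m w i)) (s i))" if "N \<ge> n" for N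
    by (rule S_weight_eq) (use word_parts_support[OF _ w] that n_def in auto)
  have Saw: "S_weight s (word_parts m (a # w)) = (\<Sum>i=1..m+n. ntimes (psize (word_parts m (a # w) i)) (s i))"
    by (rule S_weight_eq, rule word_parts_support[OF _ Cons.prems]) (simp add: n_def)
  show ?case
  proof (cases "a = 0")
    case True
    then show ?thesis using Cons by simp
  next
    case a: False
    show ?thesis
    proof (cases "w \<noteq> [] \<and> a < hd w")
      case True
      have "psize (word_parts m (a # w) i) = psize (word_parts m w i) + of_bool (i \<le> a)" if "1 \<le> i" for i
        using True a that word_parts_less_hd[of w i m] by auto
      then have "S_weight s (word_parts m (a # w)) =
          (\<Sum>i=1..m+n. ntimes (psize (word_parts m w i) + of_bool (i \<le> a)) (s i))"
        unfolding Saw by (intro sum.cong) auto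
      also have "\<dots> = S_weight s (word_parts m w) + psum s a"
        using am Sw[of "m + n"] by (subst sum_ntimes_step) simp_all
      finally show ?thesis
        using True Cons.IH[OF w] by (simp add: ac_simps)
    next
      case False
      have "(\<Sum>i=1..m+n. ntimes (psize (word_parts m (a # w) i)) (s i)) =
          (\<Sum>i=1..m. ntimes (psize (word_parts m (a # w) i)) (s i)) +
          (\<Sum>i=1+m..n+m. ntimes (psize (word_parts m (a # w) i)) (s i))"
        using sum.ub_add_nat[of 1 m "\<lambda>i. ntimes (psize (word_parts m (a # w) i)) (s i)" n]
        by (simp add: add.commute del: word_parts.simps)
      also have "(\<Sum>i=1..m. ntimes (psize (word_parts m (a # w) i)) (s i)) =
          (\<Sum>i=1..m. ntimes (x + of_bool (i \<le> a)) (s i))"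
        by (rule sum.cong) (use a False in \<open>auto simp: x_def\<close>)
      also have "\<dots> = ntimes x (psum s m) + psum s a"
        by (subst sum_ntimes_step[OF am]) (simp add: ntimes_sum)
      also have "(\<Sum>i=1+m..n+m. ntimes (psize (word_parts m (a # w) i)) (s i)) =
          (\<Sum>i=1..n. ntimes (psize (word_parts m (a # w) (i + m))) (s (i + m)))"
        by (rule sum.shift_bounds_cl_nat_ivl)
      also have "\<dots> = (\<Sum>i=1..n. ntimes (psize (word_parts m w i)) (s i))"
        by (rule sum.cong) (use a am False assms(1) in auto)
      also have "\<dots> = S_weight s (word_parts m w)"
        using Sw[of n] by simp
      finally have "S_weight s (word_parts m (a # w)) = ntimes x (psum s m) + psum s a + S_weight s (word_parts m w)"
        unfolding Saw .
      moreover have "wmaj (a # w) = wmaj w + x"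
        using False a by (auto simp: x_def)
      ultimately show ?thesis
        using Cons.IH[OF w] by (simp add: ntimes_add ac_simps del: wmaj.simps)
    qed
  qed
qed

text \<open>Old over-lined parts stay in place or move by a full period, so residues modulo
  \<open>m\<close> persist, and each nonzero letter adds one part at its own residue.\<close>

lemma rho_bar_word_parts:
  assumes "1 \<le> j" "j \<le> m" "set w \<subseteq> {..m}"
  shows "rho_bar m j (word_parts m w) = count (mset w) j"
  using assms(3)
proof (induction w)
  case Nil
  show ?case by (simp add: rho_bar_def)
next
  case (Cons a w)
  define X where "X = {i. is_overlined (word_parts m w (j + i * m))}"
  have IH: "card X = count (mset w) j"
    using Cons by (simp add: X_def rho_bar_def)
  have am: "a \<le> m" using Cons.prems by simp
  have "X \<subseteq> {..m * length w}"
  proof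
    fix i assume "i \<in> X"
    then have "\<not> m * length w < j + i * m"
      using word_parts_support[of m w "j + i * m"] Cons.prems by (auto simp: X_def)
    moreover have "i \<le> i * m" using assms(1,2) by simp
    ultimately show "i \<in> {..m * length w}"
      unfolding atMost_iff by linarith
  qed
  then have fin: "finite X" by (rule finite_subset) simp
  show ?case
  proof (cases "a = 0")
    case True
    with Cons assms(1) show ?thesis by (simp add: rho_bar_def)
  next
    case a: False
    show ?thesis
    proof (cases "w \<noteq> [] \<and> a < hd w")
      case True
      have "{i. is_overlined (word_parts m (a # w) (j + i * m))} = X \<union> (if j = a then {0} else {})"
      proof (rule set_eqI)
        fix i
        have "j + i * m > a" if "i \<noteq> 0"
          using that assms(1) am by (cases i) auto
        moreover have "j + i * m \<noteq> 0" using assms(1) by simp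
        ultimately show "i \<in> {i. is_overlined (word_parts m (a # w) (j + i * m))} \<longleftrightarrow>
            i \<in> X \<union> (if j = a then {0} else {})"
          using True a word_parts_less_hd[of w "j + i * m" m]
          by (cases "i = 0") (auto simp: X_def)
      qed
      moreover have "0 \<notin> X" if "j = a"
        using that True assms(1) word_parts_less_hd[of w a m] by (simp add: X_def)
      ultimately show ?thesis
        using IH fin by (auto simp: rho_bar_def)
    next
      case False
      have "{i. is_overlined (word_parts m (a # w) (j + i * m))} = Suc ` X \<union> (if j = a then {0} else {})"
      proof (rule set_eqI)
        fix i
        show "i \<in> {i. is_overlined (word_parts m (a # w) (j + i * m))} \<longleftrightarrow>
            i \<in> Suc ` X \<union> (if j = a then {0} else {})"
        proof (cases i)
          case 0
          then show ?thesis
            using False a assms by auto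
        next
          case (Suc k)
          then have "j + i * m > m" "j + i * m - m = j + k * m"
            using assms(1) by auto
          then have "word_parts m (a # w) (j + i * m) = word_parts m w (j + k * m)"
            using False a am by auto
          with Suc show ?thesis
            by (auto simp: X_def)
        qed
      qed
      moreover have "card (Suc ` X) = card X"
        by (simp add: card_image)
      ultimately show ?thesis
        using IH fin by (auto simp: rho_bar_def)
    qed
  qed
qed

text \<open>For \<open>j < m\<close> no index \<open>j + i * m\<close> is a multiple of
  \<open>m\<close>, so all terms of \<open>rho\<close> vanish; for \<open>j = m\<close> the factor
  is a power of \<open>c m = 1\<close>.\<close>

lemma color_sequence_eq:
  assumes "c m = 1"
    and "\<And>i. i \<ge> 1 \<Longrightarrow> \<not> m dvd i \<Longrightarrow>
           psize (l i) = psize (l (i + 1)) + of_bool (is_overlined (l i))"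
  shows "color_sequence c cbar m l = (\<Prod>j=1..m. cbar j ^ rho_bar m j l)"
  unfolding color_sequence_def
proof (rule prod.cong)
  fix j assume j: "j \<in> {1..m}"
  have "rho m j l = 0" if "j \<noteq> m"
  proof -
    have "\<not> m dvd j + i * m" for i
      using j that by (auto dest!: dvd_imp_le)
    then show ?thesis
      using assms(2)[of "j + i * m" for i] j unfolding rho_def by (intro sum.neutral) auto
  qed
  with assms(1) show "c j ^ rho m j l * cbar j ^ rho_bar m j l = cbar j ^ rho_bar m j l"
    by (cases "j = m") auto
qed simp

section \<open>Finite sets of positions and \<open>Fbar\<close>\<close>

definition tail_card :: "nat set \<Rightarrow> nat \<Rightarrow> nat" where
  "tail_card A i = card {j \<in> A. i \<le> j}"

lemma tail_card_Suc: "finite A \<Longrightarrow> tail_card A i = tail_card A (i + 1) + of_bool (i \<in> A)"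
proof -
  assume "finite A"
  moreover have "{j \<in> A. i \<le> j} = {j \<in> A. i + 1 \<le> j} \<union> (if i \<in> A then {i} else {})"
    by (auto simp: Suc_le_eq order.strict_iff_order)
  ultimately show ?thesis
    by (auto simp: tail_card_def)
qed

text \<open>In \<open>Fbar\<close> the size falls by one right after each over-lined part and
  nowhere else, so the size at \<open>i\<close> has to be the number of over-lined positions from
  \<open>i\<close> on.\<close>

definition staircase :: "nat set \<Rightarrow> nat \<Rightarrow> opart" where
  "staircase A i =
     (if i = 0 then Plain 0 else if i \<in> A then Overlined (tail_card A i) else Plain (tail_card A i))"

lemma psize_staircase: "i \<ge> 1 \<Longrightarrow> psize (staircase A i) = tail_card A i"
  by (simp add: staircase_def)

lemma is_overlined_staircase: "i \<ge> 1 \<Longrightarrow> is_overlined (staircase A i) \<longleftrightarrow> i \<in> A"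
  by (simp add: staircase_def)

lemma staircase_support:
  assumes "A \<subseteq> {..n}" "i > n"
  shows "staircase A i = Plain 0"
proof -
  have "{j \<in> A. i \<le> j} = {}" "i \<notin> A"
    using assms by auto
  then have "tail_card A i = 0"
    by (simp only: tail_card_def card.empty)
  with \<open>i \<notin> A\<close> show ?thesis
    by (simp add: staircase_def)
qed

lemma bij_betw_staircase: "bij_betw staircase {A. finite A \<and> 0 \<notin> A} Fbar"
proof (rule bij_betw_byWitness[where f' = "\<lambda>l. {i. i \<ge> 1 \<and> is_overlined (l i)}"])
  let ?g = "\<lambda>l. {i. i \<ge> 1 \<and> is_overlined (l i)}"
  show "\<forall>A \<in> {A. finite A \<and> 0 \<notin> A}. ?g (staircase A) = A"
  proof clarify
    fix A :: "nat set" assume "0 \<notin> A"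
    then have "i \<ge> 1 \<and> is_overlined (staircase A i) \<longleftrightarrow> i \<in> A" for i
      using is_overlined_staircase[of i A] by (cases "i = 0") auto
    then show "?g (staircase A) = A"
      by blast
  qed
  show "staircase ` {A. finite A \<and> 0 \<notin> A} \<subseteq> Fbar"
  proof clarify
    fix A :: "nat set" assume A: "finite A" "0 \<notin> A"
    have step: "psize (staircase A i) = psize (staircase A (i + 1)) + of_bool (is_overlined (staircase A i))"
      if "i \<ge> 1" for i
      using that tail_card_Suc[OF A(1), of i] by (simp add: psize_staircase is_overlined_staircase)
    have pos: "staircase A i \<noteq> Overlined 0" for i
    proof
      assume *: "staircase A i = Overlined 0"
      then have "i \<ge> 1" by (cases "i = 0") (simp_all add: staircase_def)
      with * step[of i] show False by simp
    qed
    obtain n where "A \<subseteq> {..n}"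
      using A(1) finite_nat_iff_bounded_le by blast
    then have "\<forall>i>n. staircase A i = Plain 0"
      using staircase_support by blast
    moreover have "staircase A 0 = Plain 0"
      by (simp add: staircase_def)
    moreover have "drops (staircase A) i" if "i \<ge> 1" for i
      using step[OF that] by (simp add: drops_def)
    ultimately show "staircase A \<in> Fbar"
      unfolding Fbar_iff overpartition_iff using step pos by blast
  qed
  have fin: "finite (?g l)" if "l \<in> Fbar" for l
  proof -
    have "finite {i. i \<ge> 1 \<and> l i \<noteq> Plain 0}"
      using that by (simp add: Fbar_def overpartition_def)
    then show ?thesis
      by (rule rev_finite_subset) auto
  qed
  then show "?g ` Fbar \<subseteq> {A. finite A \<and> 0 \<notin> A}"
    by auto
  show "\<forall>l \<in> Fbar. staircase (?g l) = l"
  proof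
    fix l assume l: "l \<in> Fbar"
    define A where "A = ?g l"
    have recur: "psize (l i) = psize (l (i + 1)) + of_bool (is_overlined (l i))" if "i \<ge> 1" for i
      using l that unfolding Fbar_iff by blast
    obtain n where n: "\<And>i. i > n \<Longrightarrow> l i = Plain 0" and l0: "l 0 = Plain 0"
      using l unfolding Fbar_iff overpartition_iff by blast
    have size: "psize (l i) = tail_card A i" if "i \<ge> 1" for i
    proof (cases "i > n")
      case True
      then have "{j \<in> A. i \<le> j} = {}"
        using n by (auto simp: A_def)
      then have "tail_card A i = 0"
        by (simp only: tail_card_def card.empty)
      with n True show ?thesis by simp
    next
      case False
      \<comment> \<open>Downward induction starts at \<open>n + 1\<close>, where both sides are
        \<open>0\<close>.\<close>
      then have "i \<le> n + 1" by simp
      then show ?thesis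
        using that
      proof (induction i rule: inc_induct)
        case base
        have "{j \<in> A. n + 1 \<le> j} = {}"
          using n by (auto simp: A_def)
        then have "tail_card A (n + 1) = 0"
          by (simp only: tail_card_def card.empty)
        with n show ?case by simp
      next
        case (step i)
        then show ?case
          using recur[of i] tail_card_Suc[of A i] fin[OF l]
          by (auto simp: A_def)
      qed
    qed
    have "staircase A i = l i" for i
    proof (cases "i = 0")
      case False
      then have "i \<in> A \<longleftrightarrow> is_overlined (l i)" by (simp add: A_def)
      with False size[of i] show ?thesis
        by (cases "l i") (auto simp: staircase_def)
    qed (simp add: staircase_def l0)
    then show "staircase (?g l) = l"
      by (auto simp: A_def)
  qed
qed

text \<open>Conjugation: an over-lined part at position \<open>a\<close> raises each of the first
  \<open>a\<close> parts by one.\<close>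

lemma S_weight_staircase:
  assumes "finite A" "0 \<notin> A"
  shows "S_weight s (staircase A) = (\<Sum>a\<in>A. psum s a)"
proof -
  obtain n where n: "A \<subseteq> {..n}"
    using assms(1) finite_nat_iff_bounded_le by blast
  have "S_weight s (staircase A) = (\<Sum>i=1..n. ntimes (tail_card A i) (s i))"
    using S_weight_eq[of n "staircase A" s] staircase_support[OF n] by (simp add: psize_staircase)
  also have "\<dots> = (\<Sum>i=1..n. \<Sum>a\<in>A. if i \<le> a then s i else 0)"
  proof (rule sum.cong[OF refl])
    fix i
    have "ntimes (tail_card A i) (s i) = (\<Sum>a\<in>{j \<in> A. i \<le> j}. s i)"
      using finite_same_card_bij[of "{..<tail_card A i}" "{j \<in> A. i \<le> j}"] assms(1)
      by (auto simp: tail_card_def intro: sum.reindex_bij_betw)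
    then show "ntimes (tail_card A i) (s i) = (\<Sum>a\<in>A. if i \<le> a then s i else 0)"
      using assms(1) by (simp add: sum.inter_filter)
  qed
  also have "\<dots> = (\<Sum>a\<in>A. \<Sum>i=1..n. if i \<le> a then s i else 0)"
    by (rule sum.swap)
  also have "\<dots> = (\<Sum>a\<in>A. psum s a)"
    by (intro sum.cong[OF refl] sum.mono_neutral_cong_right) (use n in auto)
  finally show ?thesis .
qed

lemma rho_bar_staircase: "j \<ge> 1 \<Longrightarrow> rho_bar m j (staircase A) = card {i. j + i * m \<in> A}"
  by (simp add: rho_bar_def is_overlined_staircase)

section \<open>Positions of over-lined parts from ranked letters\<close>

definition positions :: "nat \<Rightarrow> nat list \<Rightarrow> nat set" where
  "positions m w = (\<lambda>(k, r). m * k + r) ` ranked w"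

text \<open>Division by \<open>m\<close> with remainders in \<open>1..m\<close> instead of
  \<open>0..m - 1\<close>, hence the shift by \<open>1\<close> in the quotients.\<close>

lemma positions_inj: "inj_on (\<lambda>(k, r). m * k + r) (UNIV \<times> {1..m::nat})"
proof (rule inj_onI, clarify)
  fix k r k' r' :: nat
  assume "r \<in> {1..m}" "r' \<in> {1..m}" and eq: "m * k + r = m * k' + r'"
  then have "k = (m * k + r - 1) div m" "k' = (m * k' + r' - 1) div m"
    by (auto simp: div_nat_eqI Suc_le_eq intro!: div_nat_eqI[symmetric])
  with eq show "k = k' \<and> r = r'"
    by simp
qed

lemma ranked_subset: "set w \<subseteq> {..m} \<Longrightarrow> ranked w \<subseteq> UNIV \<times> {1..m}"
  by (induction w) (auto simp: Suc_le_eq split: if_splits)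

lemma ranked_dropWhile_0 [simp]: "ranked (dropWhile (\<lambda>x. x = 0) w) = ranked w"
  by (induction w) auto

text \<open>The shorter word is padded with zeros to equal length; any actual padding would leave a
  zero at the head of the longer word.\<close>

lemma ranked_words_inject:
  assumes "v \<in> words m" "w \<in> words m" "ranked v = ranked w"
  shows "v = w"
proof -
  have *: "v = w" if "length v \<le> length w" "w \<in> words m" "ranked v = ranked w" for v w
  proof -
    define n where "n = length w - length v"
    have "replicate n 0 @ v = w"
      by (rule ranked_inject) (use that in \<open>simp_all add: n_def\<close>)
    with that(2) show ?thesis
      by (cases n) (auto simp: words_def)
  qed
  show ?thesis
    using *[of v w] *[of w v] assms by (cases "length v \<le> length w") auto
qed

lemma bij_betw_positions:
  assumes "m \<ge> 1"
  shows "bij_betw (positions m) (words m) {A. finite A \<and> 0 \<notin> A}"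
  unfolding bij_betw_def
proof
  show "inj_on (positions m) (words m)"
  proof (rule inj_onI)
    fix v w assume *: "v \<in> words m" "w \<in> words m" "positions m v = positions m w"
    then have "ranked v = ranked w"
      using inj_on_image_eq_iff[OF positions_inj ranked_subset ranked_subset, of v m w]
      by (simp add: positions_def words_def)
    with * show "v = w"
      using ranked_words_inject by blast
  qed
  show "positions m ` words m = {A. finite A \<and> 0 \<notin> A}"
  proof (intro equalityI subsetI)
    fix A assume "A \<in> positions m ` words m"
    then obtain w where "w \<in> words m" "A = positions m w" by blast
    moreover from this have "ranked w \<subseteq> UNIV \<times> {1..m}"
      by (intro ranked_subset) (simp add: words_def)
    ultimately show "A \<in> {A. finite A \<and> 0 \<notin> A}"
      by (auto simp: positions_def)
  next
    fix A :: "nat set" assume "A \<in> {A. finite A \<and> 0 \<notin> A}"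
    then have A: "finite A" "0 \<notin> A" by auto
    \<comment> \<open>Inverse of \<open>(k, r) \<mapsto> m * k + r\<close>, with the remainder taken
      in \<open>1..m\<close>.\<close>
    define g where "g = (\<lambda>a. ((a - 1) div m, (a - 1) mod m + 1))"
    have g: "m * fst (g a) + snd (g a) = a" if "a \<in> A" for a
      using that A(2) mult_div_mod_eq[of m "a - 1"] by (cases a) (auto simp: g_def)
    have g2: "snd (g a) \<in> {1..m}" for a
      using assms by (simp add: g_def Suc_le_eq)
    have "finite (g ` A)" "0 \<notin> snd ` g ` A"
      using A(1) by (auto simp: g_def)
    from ranked_surj[OF this] obtain w
      where w: "ranked w = g ` A" "set w \<subseteq> insert 0 (snd ` g ` A)"
      by (elim exE conjE)
    define u where "u = dropWhile (\<lambda>x. x = 0) w"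
    have "set u \<subseteq> {..m}"
    proof
      fix x assume "x \<in> set u"
      then have "x \<in> insert 0 (snd ` g ` A)"
        using w(2) set_dropWhileD[of x "\<lambda>x. x = 0" w] by (auto simp: u_def)
      then show "x \<in> {..m}"
        using g2 by auto
    qed
    moreover have "hd u \<noteq> 0" if "u \<noteq> []"
      using that hd_dropWhile[of "\<lambda>x. x = 0" w] by (simp add: u_def)
    ultimately have "u \<in> words m"
      by (simp add: words_def)
    moreover have "positions m u = A"
    proof -
      have "positions m u = (\<lambda>a. m * fst (g a) + snd (g a)) ` A"
        using w(1) by (simp add: positions_def u_def image_image case_prod_unfold)
      also have "\<dots> = (\<lambda>a. a) ` A"
        by (rule image_cong) (use g in auto)
      finally show ?thesis by simp
    qed
    ultimately show "A \<in> positions m ` words m" by blast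
  qed
qed

lemma psum_period:
  fixes s :: "nat \<Rightarrow> 'a::comm_monoid_add"
  assumes "\<And>i. i \<ge> 1 \<Longrightarrow> s (i + m) = s i"
  shows "psum s (m * k + r) = ntimes k (psum s m) + psum s r"
proof (induction k)
  case (Suc k)
  have "psum s (m * Suc k + r) = psum s m + (\<Sum>i=1+m..m*k+r+m. s i)"
    using sum.ub_add_nat[of 1 m s "m * k + r"] by (simp add: add_ac)
  also have "(\<Sum>i=1+m..m*k+r+m. s i) = (\<Sum>i=1..m*k+r. s (i + m))"
    by (rule sum.shift_bounds_cl_nat_ivl)
  also have "\<dots> = psum s (m * k + r)"
    by (rule sum.cong) (use assms in auto)
  finally show ?case
    using Suc by (simp add: add_ac)
qed simp

text \<open>A letter \<open>a\<close> of rank \<open>k\<close> yields \<open>k\<close> full periods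
  and the initial sum \<open>psum s a\<close>; the ranks add up to \<open>winv w\<close>.\<close>

lemma sum_positions:
  fixes s :: "nat \<Rightarrow> 'a::comm_monoid_add"
  assumes "\<And>i. i \<ge> 1 \<Longrightarrow> s (i + m) = s i" "set w \<subseteq> {..m}"
  shows "(\<Sum>a\<in>positions m w. psum s a) = (\<Sum>a\<in>#mset w. psum s a) + ntimes (winv w) (psum s m)"
proof -
  have "(\<Sum>a\<in>positions m w. psum s a) = (\<Sum>(k, r)\<in>ranked w. psum s (m * k + r))"
    unfolding positions_def
    using inj_on_subset[OF positions_inj ranked_subset[OF assms(2)]]
    by (subst sum.reindex) (auto simp: case_prod_unfold)
  also have "\<dots> = (\<Sum>(k, r)\<in>ranked w. ntimes k (psum s m) + psum s r)"
    by (simp only: psum_period[of s, OF assms(1)])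
  also have "\<dots> = (\<Sum>a\<in>#mset w. psum s a) + ntimes (winv w) (psum s m)"
  proof (induction w)
    case (Cons a w)
    have "(count_le a w, a) \<notin> ranked w"
      using ranked_less by blast
    with Cons show ?case
      by (simp add: ntimes_add add_ac)
  qed simp
  finally show ?thesis .
qed

text \<open>Positions with residue \<open>j\<close> correspond to the ranks of the letters
  \<open>j\<close>, which are pairwise distinct.\<close>

lemma card_positions:
  assumes "1 \<le> j" "j \<le> m" "set w \<subseteq> {..m}"
  shows "card {i. j + i * m \<in> positions m w} = count (mset w) j"
proof -
  have "j + i * m \<in> positions m w \<longleftrightarrow> (i, j) \<in> ranked w" for i
  proof
    assume "j + i * m \<in> positions m w"
    then obtain k r where kr: "(k, r) \<in> ranked w" "m * k + r = m * i + j"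
      by (auto simp: positions_def algebra_simps)
    with inj_onD[OF positions_inj, of m "(k, r)" "(i, j)"] ranked_subset[OF assms(3)] assms(1,2)
    show "(i, j) \<in> ranked w" by auto
  qed (force simp: positions_def algebra_simps)
  moreover have "card {i. (i, j) \<in> ranked w} = count (mset w) j"
  proof (induction w)
    case (Cons a w)
    have "finite {i. (i, j) \<in> ranked w}"
      by (rule finite_subset[of _ "fst ` ranked w"]) force+
    moreover have "count_le j w \<notin> {i. (i, j) \<in> ranked w}"
      using ranked_less by blast
    moreover have "{i. (i, j) \<in> ranked (a # w)} =
        (if a = j then insert (count_le j w) {i. (i, j) \<in> ranked w} else {i. (i, j) \<in> ranked w})"
      using assms(1) by auto
    ultimately show ?case
      using Cons by (simp del: ranked.simps)
  qed simp
  ultimately show ?thesis by simp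
qed

section \<open>The bijection\<close>

theorem corollary1p17:
  fixes m :: nat
    and s :: "nat \<Rightarrow> 'a::comm_monoid_add"
    and c cbar :: "nat \<Rightarrow> 'c::comm_monoid_mult"
    and w :: 'a and C :: 'c
  assumes "m \<ge> 1"
    and "\<And>i. i \<ge> 1 \<Longrightarrow> s (i + m) = s i"
    and "\<And>u. c (u + m) = c u"
    and "\<And>u. cbar (u + m) = cbar u"
    and "c m = 1" and "c 0 = 1"
    and "independent_colors m c cbar"
  shows "{l \<in> Fbar. S_weight s l = w \<and> color_sequence c cbar m l = C} \<approx>
         {l \<in> Fbar_m m. S_weight s l = w \<and> color_sequence c cbar m l = C}"
proof -
  \<comment> \<open>\<open>foata\<close> is applied on this side because \<open>positions\<close>
    turns \<open>winv\<close> into weight, while \<open>word_parts\<close> uses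
    \<open>wmaj\<close>.\<close>
  define f where "f = (\<lambda>v. staircase (positions m (foata v)))"
  have f: "bij_betw f (words m) Fbar"
    using bij_betw_trans[OF bij_betw_trans[OF bij_betw_foata bij_betw_positions[OF assms(1)]]
        bij_betw_staircase]
    by (simp add: f_def comp_def)
  have g: "bij_betw (word_parts m) (words m) (Fbar_m m)"
    by (rule bij_betw_word_parts[OF assms(1)])
  have same: "S_weight s (f v) = S_weight s (word_parts m v) \<and>
      color_sequence c cbar m (f v) = color_sequence c cbar m (word_parts m v)" if "v \<in> words m" for v
  proof
    have v: "set v \<subseteq> {..m}" "set (foata v) \<subseteq> {..m}"
      using that by (auto simp: words_def)
    have "foata v \<in> words m"
      using that bij_betw_foata bij_betwE by blast
    then have pos: "finite (positions m (foata v))" "0 \<notin> positions m (foata v)"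
      using bij_betw_positions[OF assms(1)] bij_betwE by blast+
    show "S_weight s (f v) = S_weight s (word_parts m v)"
      using S_weight_staircase[OF pos, of s] sum_positions[of s m, OF _ v(2)]
        S_weight_word_parts[of s m, OF _ v(1)] assms(2)
      by (simp add: f_def winv_foata)
    have "color_sequence c cbar m (f v) = (\<Prod>j=1..m. cbar j ^ count (mset v) j)"
    proof -
      have "f v \<in> Fbar"
        using f that bij_betwE by blast
      then have "color_sequence c cbar m (f v) = (\<Prod>j=1..m. cbar j ^ rho_bar m j (f v))"
        unfolding Fbar_iff by (intro color_sequence_eq assms(5)) blast
      also have "\<dots> = (\<Prod>j=1..m. cbar j ^ count (mset v) j)"
        using card_positions[OF _ _ v(2)] by (intro prod.cong) (auto simp: f_def rho_bar_staircase)
      finally show ?thesis .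
    qed
    also have "\<dots> = (\<Prod>j=1..m. cbar j ^ rho_bar m j (word_parts m v))"
      using v(1) by (intro prod.cong) (auto simp: rho_bar_word_parts)
    also have "\<dots> = color_sequence c cbar m (word_parts m v)"
      using word_parts_in_Fbar_m[OF assms(1) v(1)] unfolding Fbar_m_iff[OF assms(1)]
      by (intro color_sequence_eq[symmetric] assms(5)) blast
    finally show "color_sequence c cbar m (f v) = color_sequence c cbar m (word_parts m v)" .
  qed
  \<comment> \<open>By \<open>same\<close>, selecting words through \<open>word_parts\<close> or
    through \<open>f\<close> gives the same set, so it can index both sides.\<close>
  define X where "X = {v \<in> words m. S_weight s (word_parts m v) = w \<and> color_sequence c cbar m (word_parts m v) = C}"
  have "bij_betw f X {l \<in> Fbar. S_weight s l = w \<and> color_sequence c cbar m l = C}"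
    by (rule bij_betw_subset[OF f])
      (auto simp: X_def same simp flip: bij_betw_imp_surj_on[OF f])
  moreover have "bij_betw (word_parts m) X {l \<in> Fbar_m m. S_weight s l = w \<and> color_sequence c cbar m l = C}"
    by (rule bij_betw_subset[OF g])
      (auto simp: X_def simp flip: bij_betw_imp_surj_on[OF g])
  ultimately show ?thesis
    by (meson eqpoll_def eqpoll_sym eqpoll_trans)
qed

end
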